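(* Let $h:\mathbb R^m\times\Omega\to\overline{\mathbb R}$ be a convex normal integrand. If $Eh$ is proper on $\mathcal U$, then 1. $(Eh)^*(y)=Eh^*(y^c)+\sigma_{\operatorname{dom}Eh}(y^s)$ for all $y\in\mathcal U^*$; 2. $Eh$ is strongly lower semicontinuous on $\mathcal U$ if and only if it is $\sigma(\mathcal U,\mathcal Y)$-lower semicontinuous; 3. for $\bar u\in\mathcal U$ and $y\in\mathcal U^*$, one has $y\in\partial Eh(\bar u)$ if and only if $y^c\in\partial Eh(\bar u)$ and $y^s\in N_{\operatorname{dom}Eh}(\bar u)$.
   Context: $(\Omega,\mathcal F,P)$ is a probability space. $\mathcal U,\mathcal Y\subset L^0(\Omega,\mathcal F,P;\mathbb R^m)$ are linear spaces in separating duality under $\langle u,y\rangle=E[u\cdot y]$. Both are decomposable ($1_Au+1_{\Omega\setminus A}u'$ belongs to the space for every $u$ in the space, $u'\in L^\infty$, $A\in\mathcal F$) and solid (if $\bar u$ is in the space and $u\in L^0$ has $|u^i|\le|\bar u^i|$ a.s. for every component $i$, then $u$ is in the space). $\mathcal U$ is endowed with a "strong" topology, at least as strong as the Mackey topology $\tau(\mathcal U,\mathcal Y)$, under which it is a Fréchet space with topological dual $\mathcal U^*=\mathcal Y\oplus\mathcal Y^s$: for every $y\in\mathcal U^*$ there are unique $y^c\in\mathcal Y$ and $y^s\in\mathcal Y^s$ with $\langle u,y\rangle=E[u\cdot y^c]+\langle u,y^s\rangle$ for all $u\in\mathcal U$. Here $\mathcal Y^s$ is the set of singular elements, i.e. those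 $y\in\mathcal U^*$ such that for every $u\in\mathcal U$ there is a decreasing sequence $(A^\nu)_{\nu\ge1}\subset\mathcal F$ with $P(A^\nu)\searrow0$ and $\langle1_{\Omega\setminus A^\nu}u,y\rangle=0$ for all $\nu$. A convex normal integrand is a function such that $h(\cdot,\omega)$ is a closed convex function for every $\omega$ and $\omega\mapsto\operatorname{epi}h(\cdot,\omega)$ is a measurable set-valued mapping; $h^*(\cdot,\omega)$ is its scenario-wise conjugate. $Eh(u):=\int h(u(\omega),\omega)\,dP(\omega)$, where the integral of an extended real-valued random variable is $+\infty$ unless its positive part is integrable; $\operatorname{dom}Eh=\{u\in\mathcal U\mid Eh(u)<\infty\}$. $(Eh)^*(y)=\sup_{u\in\mathcal U}\{\langle u,y\rangle-Eh(u)\}$ and the subdifferential $\partial Eh$ are taken with respect to the pairing of $\mathcal U$ with $\mathcal U^*$ ($y\in\partial Eh(\bar u)$ means $Eh(\bar u)$ is finite and $Eh(u)\ge Eh(\bar u)+\langle u-\bar u,y\rangle$ for all $u\in\mathcal U$). $\sigma_C(y)=\sup_{u\in C}\langle u,y\rangle$, and $N_C(\bar u)=\{y\in\mathcal U^*\mid\langle u-\bar u,y\rangle\le0\ \forall u\in C\}$ if $\bar u\in C$, $N_C(\bar u)=\emptyset$ otherwise. *)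

theory Defs
  imports "HOL-Probability.Probability"
begin

text \<open>
  Elements of \<open>L\<^sup>0\<close> are represented by measurable functions; almost sure equality takes the place
  of equality. A solid space contains, with each function, every measurable function that is almost
  surely equal to it, so a solid space of functions is the same thing as a solid space of classes.
\<close>

definition linear_space :: "('a \<Rightarrow> 'v::real_vector) set \<Rightarrow> bool" where
  "linear_space U \<longleftrightarrow> (\<lambda>\<omega>. 0) \<in> U \<and>
     (\<forall>u\<in>U. \<forall>v\<in>U. \<forall>a b. (\<lambda>\<omega>. a *\<^sub>R u \<omega> + b *\<^sub>R v \<omega>) \<in> U)"

definition decomposable :: "'a measure \<Rightarrow> ('a \<Rightarrow> real^'m) set \<Rightarrow> bool" where
  "decomposable M U \<longleftrightarrow>
     (\<forall>u\<in>U. \<forall>u'\<in>borel_measurable M. (\<exists>C. AE \<omega> in M. norm (u' \<omega>) \<le> C) \<longrightarrow>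
        (\<forall>A\<in>sets M. (\<lambda>\<omega>. if \<omega> \<in> A then u \<omega> else u' \<omega>) \<in> U))"

definition solid :: "'a measure \<Rightarrow> ('a \<Rightarrow> real^'m) set \<Rightarrow> bool" where
  "solid M U \<longleftrightarrow>
     (\<forall>v\<in>U. \<forall>u\<in>borel_measurable M. (\<forall>i. AE \<omega> in M. \<bar>u \<omega> $ i\<bar> \<le> \<bar>v \<omega> $ i\<bar>) \<longrightarrow> u \<in> U)"

definition pairing :: "'a measure \<Rightarrow> ('a \<Rightarrow> real^'m) \<Rightarrow> ('a \<Rightarrow> real^'m) \<Rightarrow> real" where
  "pairing M u y = (LINT \<omega>|M. u \<omega> \<bullet> y \<omega>)"

definition separating_duality ::
  "'a measure \<Rightarrow> ('a \<Rightarrow> real^'m) set \<Rightarrow> ('a \<Rightarrow> real^'m) set \<Rightarrow> bool" where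
  "separating_duality M U Y \<longleftrightarrow>
     (\<forall>u\<in>U. \<forall>y\<in>Y. integrable M (\<lambda>\<omega>. u \<omega> \<bullet> y \<omega>)) \<and>
     (\<forall>u\<in>U. (\<forall>y\<in>Y. pairing M u y = 0) \<longrightarrow> (AE \<omega> in M. u \<omega> = 0)) \<and>
     (\<forall>y\<in>Y. (\<forall>u\<in>U. pairing M u y = 0) \<longrightarrow> (AE \<omega> in M. y \<omega> = 0))"

definition seminorm_on :: "('a \<Rightarrow> 'v::real_vector) set \<Rightarrow> (('a \<Rightarrow> 'v) \<Rightarrow> real) \<Rightarrow> bool" where
  "seminorm_on U p \<longleftrightarrow>
     (\<forall>u\<in>U. \<forall>v\<in>U. p (\<lambda>\<omega>. u \<omega> + v \<omega>) \<le> p u + p v) \<and>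
     (\<forall>u\<in>U. \<forall>a. p (\<lambda>\<omega>. a *\<^sub>R u \<omega>) = \<bar>a\<bar> * p u)"

definition seminorm_topology ::
  "('a \<Rightarrow> 'v::real_vector) set \<Rightarrow> (('a \<Rightarrow> 'v) \<Rightarrow> real) set \<Rightarrow> ('a \<Rightarrow> 'v) topology" where
  "seminorm_topology U P = topology_generated_by
     {{v \<in> U. p (\<lambda>\<omega>. v \<omega> - u \<omega>) < e} | p u e. p \<in> P \<and> u \<in> U \<and> 0 < e}"

definition weak_topology ::
  "'a measure \<Rightarrow> ('a \<Rightarrow> real^'m) set \<Rightarrow> ('a \<Rightarrow> real^'m) set \<Rightarrow> ('a \<Rightarrow> real^'m) topology" where
  "weak_topology M U Y = seminorm_topology U ((\<lambda>y u. \<bar>pairing M u y\<bar>) ` Y)"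

definition absolutely_convex :: "('a \<Rightarrow> 'v::real_vector) set \<Rightarrow> bool" where
  "absolutely_convex K \<longleftrightarrow> K \<noteq> {} \<and>
     (\<forall>y\<in>K. \<forall>z\<in>K. \<forall>a b. \<bar>a\<bar> + \<bar>b\<bar> \<le> 1 \<longrightarrow> (\<lambda>\<omega>. a *\<^sub>R y \<omega> + b *\<^sub>R z \<omega>) \<in> K)"

text \<open>
  The Mackey topology \<open>\<tau>(U,Y)\<close> is that of uniform convergence on the absolutely convex
  \<open>\<sigma>(Y,U)\<close>-compact subsets of \<open>Y\<close>; the pairing is symmetric, whence \<open>weak_topology M Y U\<close>.
\<close>

definition mackey_topology ::
  "'a measure \<Rightarrow> ('a \<Rightarrow> real^'m) set \<Rightarrow> ('a \<Rightarrow> real^'m) set \<Rightarrow> ('a \<Rightarrow> real^'m) topology" where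
  "mackey_topology M U Y = seminorm_topology U
     {\<lambda>u. SUP y\<in>K. \<bar>pairing M u y\<bar> | K. absolutely_convex K \<and> compactin (weak_topology M Y U) K}"

definition frechet_space ::
  "'a measure \<Rightarrow> ('a \<Rightarrow> real^'m) set \<Rightarrow> ('a \<Rightarrow> real^'m) topology \<Rightarrow> bool" where
  "frechet_space M U T \<longleftrightarrow>
     (\<exists>p :: nat \<Rightarrow> ('a \<Rightarrow> real^'m) \<Rightarrow> real.
        (\<forall>n. seminorm_on U (p n)) \<and> T = seminorm_topology U (range p) \<and>
        (\<forall>u\<in>U. (\<forall>n. p n u = 0) \<longleftrightarrow> (AE \<omega> in M. u \<omega> = 0)) \<and>
        (\<forall>s. range s \<subseteq> U \<and>
             (\<forall>n. \<forall>e>0. \<exists>N. \<forall>j\<ge>N. \<forall>k\<ge>N. p n (\<lambda>\<omega>. s j \<omega> - s k \<omega>) < e) \<longrightarrow>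
             (\<exists>u\<in>U. \<forall>n. (\<lambda>k. p n (\<lambda>\<omega>. s k \<omega> - u \<omega>)) \<longlonglongrightarrow> 0)))"

text \<open>
  Functionals on \<open>U\<close> are HOL functions on the whole function type; they are made extensional, so
  that equality of functionals is equality on \<open>U\<close>.
\<close>

definition dual ::
  "('a \<Rightarrow> 'v::real_vector) set \<Rightarrow> ('a \<Rightarrow> 'v) topology \<Rightarrow> (('a \<Rightarrow> 'v) \<Rightarrow> real) set" where
  "dual U T = {\<phi> \<in> extensional U.
     (\<forall>u\<in>U. \<forall>v\<in>U. \<forall>a b. \<phi> (\<lambda>\<omega>. a *\<^sub>R u \<omega> + b *\<^sub>R v \<omega>) = a * \<phi> u + b * \<phi> v) \<and>
     continuous_map T euclideanreal \<phi>}"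

definition functional_of ::
  "'a measure \<Rightarrow> ('a \<Rightarrow> real^'m) set \<Rightarrow> ('a \<Rightarrow> real^'m) \<Rightarrow> (('a \<Rightarrow> real^'m) \<Rightarrow> real)" where
  "functional_of M U y = (\<lambda>u\<in>U. pairing M u y)"

definition singular_dual ::
  "'a measure \<Rightarrow> ('a \<Rightarrow> real^'m) set \<Rightarrow> ('a \<Rightarrow> real^'m) topology \<Rightarrow>
     (('a \<Rightarrow> real^'m) \<Rightarrow> real) set" where
  "singular_dual M U T = {\<phi> \<in> dual U T. \<forall>u\<in>U. \<exists>A :: nat \<Rightarrow> 'a set.
     range A \<subseteq> sets M \<and> decseq A \<and> (\<lambda>n. measure M (A n)) \<longlonglongrightarrow> 0 \<and>
     (\<forall>n. \<phi> (\<lambda>\<omega>. indicat_real (space M - A n) \<omega> *\<^sub>R u \<omega>) = 0)}"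

definition decomposes ::
  "'a measure \<Rightarrow> ('a \<Rightarrow> real^'m) set \<Rightarrow> (('a \<Rightarrow> real^'m) \<Rightarrow> real) \<Rightarrow> ('a \<Rightarrow> real^'m) \<Rightarrow>
     (('a \<Rightarrow> real^'m) \<Rightarrow> real) \<Rightarrow> bool" where
  "decomposes M U \<phi> yc ys \<longleftrightarrow> (\<forall>u\<in>U. \<phi> u = pairing M u yc + ys u)"

definition dual_is_direct_sum ::
  "'a measure \<Rightarrow> ('a \<Rightarrow> real^'m) set \<Rightarrow> ('a \<Rightarrow> real^'m) set \<Rightarrow> ('a \<Rightarrow> real^'m) topology \<Rightarrow> bool" where
  "dual_is_direct_sum M U Y T \<longleftrightarrow>
     functional_of M U ` Y \<subseteq> dual U T \<and>
     (\<forall>\<phi>\<in>dual U T. \<exists>yc\<in>Y. \<exists>ys\<in>singular_dual M U T. decomposes M U \<phi> yc ys \<and>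
        (\<forall>yc'\<in>Y. \<forall>ys'\<in>singular_dual M U T. decomposes M U \<phi> yc' ys' \<longrightarrow>
           (AE \<omega> in M. yc' \<omega> = yc \<omega>) \<and> ys' = ys))"

definition ereal_epigraph :: "('v \<Rightarrow> ereal) \<Rightarrow> ('v \<times> real) set" where
  "ereal_epigraph f = {(x, r). f x \<le> ereal r}"

definition measurable_set_valued ::
  "'a measure \<Rightarrow> ('a \<Rightarrow> 'b::topological_space set) \<Rightarrow> bool" where
  "measurable_set_valued M S \<longleftrightarrow> (\<forall>G. open G \<longrightarrow> {\<omega> \<in> space M. S \<omega> \<inter> G \<noteq> {}} \<in> sets M)"

definition convex_normal_integrand :: "'a measure \<Rightarrow> (real^'m \<Rightarrow> 'a \<Rightarrow> ereal) \<Rightarrow> bool" where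
  "convex_normal_integrand M h \<longleftrightarrow>
     (\<forall>\<omega>\<in>space M. closed (ereal_epigraph (\<lambda>x. h x \<omega>)) \<and> convex (ereal_epigraph (\<lambda>x. h x \<omega>))) \<and>
     measurable_set_valued M (\<lambda>\<omega>. ereal_epigraph (\<lambda>x. h x \<omega>))"

definition conjugate :: "(real^'m \<Rightarrow> 'a \<Rightarrow> ereal) \<Rightarrow> (real^'m \<Rightarrow> 'a \<Rightarrow> ereal)" where
  "conjugate h y \<omega> = (SUP x. ereal (x \<bullet> y) - h x \<omega>)"

text \<open>\<open>e2ennreal\<close> sends negative values to \<open>0\<close>, so the two integrals are those of the positive and
  the negative part of \<open>f\<close>.\<close>

definition ereal_integral :: "'a measure \<Rightarrow> ('a \<Rightarrow> ereal) \<Rightarrow> ereal" where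
  "ereal_integral M f =
     (if (\<integral>\<^sup>+\<omega>. e2ennreal (f \<omega>) \<partial>M) = \<infinity> then \<infinity>
      else enn2ereal (\<integral>\<^sup>+\<omega>. e2ennreal (f \<omega>) \<partial>M) - enn2ereal (\<integral>\<^sup>+\<omega>. e2ennreal (- f \<omega>) \<partial>M))"

definition integral_functional ::
  "'a measure \<Rightarrow> (real^'m \<Rightarrow> 'a \<Rightarrow> ereal) \<Rightarrow> ('a \<Rightarrow> real^'m) \<Rightarrow> ereal" where
  "integral_functional M h u = ereal_integral M (\<lambda>\<omega>. h (u \<omega>) \<omega>)"

definition proper_on :: "'u set \<Rightarrow> ('u \<Rightarrow> ereal) \<Rightarrow> bool" where
  "proper_on U F \<longleftrightarrow> (\<forall>u\<in>U. F u \<noteq> -\<infinity>) \<and> (\<exists>u\<in>U. F u < \<infinity>)"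

definition effective_domain :: "'u set \<Rightarrow> ('u \<Rightarrow> ereal) \<Rightarrow> 'u set" where
  "effective_domain U F = {u \<in> U. F u < \<infinity>}"

definition conjugate_functional :: "'u set \<Rightarrow> ('u \<Rightarrow> ereal) \<Rightarrow> ('u \<Rightarrow> real) \<Rightarrow> ereal" where
  "conjugate_functional U F \<phi> = (SUP u\<in>U. ereal (\<phi> u) - F u)"

definition support_functional :: "'u set \<Rightarrow> ('u \<Rightarrow> real) \<Rightarrow> ereal" where
  "support_functional C \<phi> = (SUP u\<in>C. ereal (\<phi> u))"

definition lsc_wrt :: "'u topology \<Rightarrow> ('u \<Rightarrow> ereal) \<Rightarrow> bool" where
  "lsc_wrt T F \<longleftrightarrow> (\<forall>a. openin T {u \<in> topspace T. a < F u})"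

definition subdifferential ::
  "('a \<Rightarrow> 'v::real_vector) set \<Rightarrow> ('a \<Rightarrow> 'v) topology \<Rightarrow> (('a \<Rightarrow> 'v) \<Rightarrow> ereal) \<Rightarrow> ('a \<Rightarrow> 'v) \<Rightarrow>
     (('a \<Rightarrow> 'v) \<Rightarrow> real) set" where
  "subdifferential U T F v = {\<phi> \<in> dual U T. \<bar>F v\<bar> \<noteq> \<infinity> \<and>
     (\<forall>u\<in>U. F v + ereal (\<phi> (\<lambda>\<omega>. u \<omega> - v \<omega>)) \<le> F u)}"

definition normal_cone ::
  "('a \<Rightarrow> 'v::real_vector) set \<Rightarrow> ('a \<Rightarrow> 'v) topology \<Rightarrow> ('a \<Rightarrow> 'v) set \<Rightarrow> ('a \<Rightarrow> 'v) \<Rightarrow>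
     (('a \<Rightarrow> 'v) \<Rightarrow> real) set" where
  "normal_cone U T C v =
     (if v \<in> C then {\<phi> \<in> dual U T. \<forall>u\<in>C. \<phi> (\<lambda>\<omega>. u \<omega> - v \<omega>) \<le> 0} else {})"

end

theory Submission
  imports Defs
begin

text \<open>
  For \<open>y \<in> Y\<close> the conjugate of \<open>Eh\<close> is \<open>Eh\<^sup>*\<close> by Rockafellar's interchange of supremum and integral; the
  measurable selections it needs are projections onto the closed convex set \<open>epi h\<close>. A singular functional
  does not notice a change of \<open>u\<close> outside arbitrarily small sets, while integrals do not notice a change on
  such sets; so the two parts of an element of the dual are optimized independently, which gives the
  conjugate formula and the subdifferential formula. If \<open>Eh\<close> is strongly lower semicontinuous, it has a
  continuous affine minorant (Hahn--Banach), so the conjugate formula provides an element of \<open>Y\<close> where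
  \<open>Eh\<^sup>*\<close> is finite. A second interchange, now for \<open>h\<^sup>*\<close> on \<open>Y\<close>, then shows that \<open>Eh\<close> is a supremum of
  affine functions with slopes in \<open>Y\<close>.
\<close>

section \<open>Measurability of projections\<close>

text \<open>The interchange inequality is stated for an arbitrary integrand \<open>f\<close>
  together with measurable pairs \<open>(x n, r n)\<close> above its graph. Thus it serves for
  \<open>h\<close> on \<open>U\<close> and for \<open>conjugate h\<close> on \<open>Y\<close> alike,
  without establishing that the conjugate is itself a normal integrand: measurability of
  \<open>conjugate h\<close> along a measurable function is obtained only almost everywhere, from a
  liminf of measurable functions. The obstacle in the lower semicontinuity statement is that the
  second interchange needs a starting element \<open>y0\<close> of \<open>Y\<close> with
  \<open>Ehc y0 < \<infinity>\<close>. It is the point to which selections are cut back, and it also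
  tilts vertical separating hyperplanes. Hahn--Banach alone yields an element of the full dual; the
  conjugate formula then shows that its component in \<open>Y\<close> is such a \<open>y0\<close>,
  because the singular component contributes only a separate summand.\<close>

lemma measurable_set_valued_meets_open:
  fixes S :: "'a \<Rightarrow> 'b::second_countable_topology set"
    and y :: "'a \<Rightarrow> 'c::second_countable_topology"
  assumes S: "measurable_set_valued M S" and y: "y \<in> borel_measurable M" and W: "open W"
  shows "{\<omega> \<in> space M. \<exists>s\<in>S \<omega>. (y \<omega>, s) \<in> W} \<in> sets M"
proof -
  obtain B1 :: "'c set set" where B1: "countable B1" "topological_basis B1"
    using ex_countable_basis by blast
  obtain B2 :: "'b set set" where B2: "countable B2" "topological_basis B2"
    using ex_countable_basis by blast
  \<comment> \<open>Boxes of basic open sets inside \<open>W\<close>: countably many, and they fill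
    \<open>W\<close>. On a single box the condition separates into one on \<open>y\<close> and one
    on \<open>S\<close>.\<close>
  define I where "I = {p \<in> B1 \<times> B2. fst p \<times> snd p \<subseteq> W}"
  have "countable I"
    using B1(1) B2(1) by (auto simp: I_def intro: countable_subset[of _ "B1 \<times> B2"])
  have W_eq: "W = (\<Union>p\<in>I. fst p \<times> snd p)"
  proof (intro equalityI subsetI)
    fix z assume "z \<in> W"
    then obtain P Q where PQ: "open P" "open Q" "z \<in> P \<times> Q" "P \<times> Q \<subseteq> W"
      using W open_prod_def by metis
    obtain P' Q' where P': "P' \<in> B1" "fst z \<in> P'" "P' \<subseteq> P" and Q': "Q' \<in> B2" "snd z \<in> Q'" "Q' \<subseteq> Q"
      using topological_basisE[OF B1(2) PQ(1)] topological_basisE[OF B2(2) PQ(2)] PQ(3)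
      by (metis mem_Times_iff)
    then have "(P', Q') \<in> I" "z \<in> P' \<times> Q'"
      using PQ by (auto simp: I_def mem_Times_iff)
    then show "z \<in> (\<Union>p\<in>I. fst p \<times> snd p)" by force
  qed (auto simp: I_def)
  have "{\<omega> \<in> space M. \<exists>s\<in>S \<omega>. (y \<omega>, s) \<in> W} =
      (\<Union>p\<in>I. (y -` fst p \<inter> space M) \<inter> {\<omega> \<in> space M. S \<omega> \<inter> snd p \<noteq> {}})"
    unfolding W_eq by auto
  also have "\<dots> \<in> sets M"
  proof (rule sets.countable_UN''[OF \<open>countable I\<close>])
    fix p assume "p \<in> I"
    then have op: "open (fst p)" "open (snd p)"
      using topological_basis_open[OF B1(2)] topological_basis_open[OF B2(2)] by (auto simp: I_def)
    show "(y -` fst p \<inter> space M) \<inter> {\<omega> \<in> space M. S \<omega> \<inter> snd p \<noteq> {}} \<in> sets M"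
      using S op y by (auto simp: measurable_set_valued_def intro!: measurable_sets)
  qed
  finally show ?thesis .
qed

text \<open>The conditions on the right are unaffected by passing to open neighbourhoods, which is what the
  definition of a measurable set-valued mapping can test.\<close>

lemma closest_point_in_closed_iff:
  fixes S :: "'b::euclidean_space set"
  assumes S: "closed S" "convex S" "S \<noteq> {}" and K: "closed K" "K \<noteq> {}"
  shows "closest_point S z \<in> K \<longleftrightarrow>
    (\<forall>n::nat. \<exists>s\<in>S. infdist s K < 1 / Suc n \<and> dist z s < infdist z S + 1 / Suc n)"
proof
  have d: "infdist z S = dist z (closest_point S z)"
    using setdist_closest_point[OF S(1,3)] by (simp add: infdist_eq_setdist)
  {
    assume "closest_point S z \<in> K"
    then show "\<forall>n::nat. \<exists>s\<in>S. infdist s K < 1 / Suc n \<and> dist z s < infdist z S + 1 / Suc n"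
      using closest_point_in_set[OF S(1,3), of z]
      by (auto intro!: bexI[of _ "closest_point S z"] simp: d)
  }
  assume "\<forall>n::nat. \<exists>s\<in>S. infdist s K < 1 / Suc n \<and> dist z s < infdist z S + 1 / Suc n"
  then obtain s where s: "\<And>n::nat. s n \<in> S" "\<And>n. infdist (s n) K < 1 / Suc n"
      "\<And>n. dist z (s n) < infdist z S + 1 / Suc n"
    by metis
  \<comment> \<open>The approximate minimizers stay in a compact set. A limit of them lies in
    \<open>K\<close> and attains the distance, so by uniqueness it is the projection.\<close>
  have "s n \<in> S \<inter> cball z (infdist z S + 1)" for n
  proof -
    have "1 / real (Suc n) \<le> 1" by simp
    then show ?thesis
      using s(1)[of n] s(3)[of n] unfolding Int_iff mem_cball by linarith
  qed
  moreover have "compact (S \<inter> cball z (infdist z S + 1))"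
    using S by (intro closed_Int_compact) auto
  ultimately obtain l r where l: "l \<in> S" and r: "strict_mono (r :: nat \<Rightarrow> nat)" "(s \<circ> r) \<longlonglongrightarrow> l"
    unfolding compact_def by (metis IntE)
  have inv0: "(\<lambda>n. 1 / real (Suc (r n))) \<longlonglongrightarrow> 0"
    using LIMSEQ_subseq_LIMSEQ[OF LIMSEQ_inverse_real_of_nat r(1)]
    by (simp add: o_def inverse_eq_divide)
  have "(\<lambda>n. infdist ((s \<circ> r) n) K) \<longlonglongrightarrow> infdist l K"
    by (intro tendsto_infdist r)
  then have "infdist l K \<le> 0"
    by (rule LIMSEQ_le[OF _ inv0]) (use s(2) in \<open>auto intro!: exI[of _ 0] less_imp_le simp del: of_nat_Suc\<close>)
  then have "l \<in> K"
    using K by (metis in_closed_iff_infdist_zero infdist_nonneg order_antisym)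
  have "(\<lambda>n. dist z ((s \<circ> r) n)) \<longlonglongrightarrow> dist z l"
    by (intro tendsto_intros r)
  moreover have "(\<lambda>n. infdist z S + 1 / real (Suc (r n))) \<longlonglongrightarrow> infdist z S + 0"
    by (intro tendsto_intros inv0)
  ultimately have "dist z l \<le> infdist z S + 0"
    by (rule LIMSEQ_le) (use s(3) in \<open>auto intro!: exI[of _ 0] less_imp_le simp del: of_nat_Suc\<close>)
  then have "\<forall>x\<in>S. dist z l \<le> dist z x"
    using infdist_le[of _ S z] by fastforce
  then have "l = closest_point S z"
    by (rule closest_point_unique[OF S(2,1) l])
  then show "closest_point S z \<in> K" using \<open>l \<in> K\<close> by simp
qed

text \<open>It suffices to treat closed sets \<open>- G\<close>. By
  \<open>closest_point_in_closed_iff\<close>, hitting one is a countable conjunction of conditions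
  that \<open>S \<omega>\<close> meets an open set depending on the parameters
  \<open>z \<omega>\<close> and \<open>infdist (z \<omega>) (S \<omega>)\<close>; hence the distance
  is shown measurable beforehand.\<close>

lemma borel_measurable_closest_point:
  fixes S :: "'a \<Rightarrow> 'b::euclidean_space set"
  assumes S: "\<And>\<omega>. \<omega> \<in> space M \<Longrightarrow> closed (S \<omega>) \<and> convex (S \<omega>) \<and> S \<omega> \<noteq> {}"
    and meas: "measurable_set_valued M S" and z[measurable]: "z \<in> borel_measurable M"
  shows "(\<lambda>\<omega>. closest_point (S \<omega>) (z \<omega>)) \<in> borel_measurable M"
proof (rule borel_measurableI)
  have [measurable]: "(\<lambda>\<omega>. infdist (z \<omega>) (S \<omega>)) \<in> borel_measurable M"
  proof (rule borel_measurableI_less)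
    fix a
    have "{\<omega> \<in> space M. infdist (z \<omega>) (S \<omega>) < a} =
        {\<omega> \<in> space M. \<exists>s\<in>S \<omega>. (z \<omega>, s) \<in> {p. dist (fst p) (snd p) < a}}"
    proof (intro Collect_cong conj_cong refl)
      fix \<omega> assume "\<omega> \<in> space M"
      then have "infdist (z \<omega>) (S \<omega>) = dist (z \<omega>) (closest_point (S \<omega>) (z \<omega>))"
          "closest_point (S \<omega>) (z \<omega>) \<in> S \<omega>"
        using S setdist_closest_point by (auto simp: infdist_eq_setdist closest_point_in_set)
      then show "(infdist (z \<omega>) (S \<omega>) < a) \<longleftrightarrow>
          (\<exists>s\<in>S \<omega>. (z \<omega>, s) \<in> {p. dist (fst p) (snd p) < a})"
        using infdist_le[of _ "S \<omega>" "z \<omega>"] by fastforce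
    qed
    also have "\<dots> \<in> sets M"
      by (intro measurable_set_valued_meets_open[OF meas z] open_Collect_less continuous_intros)
    finally show "{\<omega> \<in> space M. infdist (z \<omega>) (S \<omega>) < a} \<in> sets M" .
  qed
  fix G :: "'b set" assume "open G"
  have "{\<omega> \<in> space M. closest_point (S \<omega>) (z \<omega>) \<in> - G} \<in> sets M"
  proof (cases "- G = {}")
    case False
    have "{\<omega> \<in> space M. closest_point (S \<omega>) (z \<omega>) \<in> - G} =
        {\<omega> \<in> space M. \<forall>n::nat. \<omega> \<in> {\<omega> \<in> space M. \<exists>s\<in>S \<omega>. ((z \<omega>, infdist (z \<omega>) (S \<omega>)), s) \<in>
          {p. infdist (snd p) (- G) < 1 / Suc n} \<inter>
          {p. dist (fst (fst p)) (snd p) < snd (fst p) + 1 / Suc n}}}"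
      using S False \<open>open G\<close>
      by (intro Collect_cong conj_cong refl) (subst closest_point_in_closed_iff, auto)
    also have "\<dots> \<in> sets M"
    proof (intro sets.sets_Collect_countable_All)
      fix n
      have "{\<omega> \<in> space M. \<exists>s\<in>S \<omega>. ((z \<omega>, infdist (z \<omega>) (S \<omega>)), s) \<in>
          {p. infdist (snd p) (- G) < 1 / Suc n} \<inter>
          {p. dist (fst (fst p)) (snd p) < snd (fst p) + 1 / Suc n}} \<in> sets M" (is "?A \<in> _")
        by (intro measurable_set_valued_meets_open[OF meas] open_Int open_Collect_less
            continuous_intros borel_measurable_Pair) measurable
      then show "{\<omega> \<in> space M. \<omega> \<in> ?A} \<in> sets M"
        by simp
    qed
    finally show ?thesis .
  qed simp
  then have "space M - {\<omega> \<in> space M. closest_point (S \<omega>) (z \<omega>) \<in> - G} \<in> sets M"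
    by auto
  also have "space M - {\<omega> \<in> space M. closest_point (S \<omega>) (z \<omega>) \<in> - G} =
      (\<lambda>\<omega>. closest_point (S \<omega>) (z \<omega>)) -` G \<inter> space M"
    by auto
  finally show "(\<lambda>\<omega>. closest_point (S \<omega>) (z \<omega>)) -` G \<inter> space M \<in> sets M" .
qed

text \<open>Empty values are replaced by the whole space, so that a closest point always exists.\<close>

definition totalize :: "'b set \<Rightarrow> 'b set" where
  "totalize S = (if S = {} then UNIV else S)"

lemma measurable_set_valued_totalize:
  fixes S :: "'a \<Rightarrow> 'b::topological_space set"
  assumes "measurable_set_valued M S"
  shows "measurable_set_valued M (\<lambda>\<omega>. totalize (S \<omega>))"
  unfolding measurable_set_valued_def
proof (intro allI impI)
  fix G :: "'b set" assume "open G"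
  then have G: "{\<omega> \<in> space M. S \<omega> \<inter> G \<noteq> {}} \<in> sets M" "{\<omega> \<in> space M. S \<omega> \<inter> UNIV \<noteq> {}} \<in> sets M"
    using assms open_UNIV unfolding measurable_set_valued_def by blast+
  have "{\<omega> \<in> space M. totalize (S \<omega>) \<inter> G \<noteq> {}} =
      (if G = {} then {} else {\<omega> \<in> space M. S \<omega> \<inter> G \<noteq> {}} \<union> (space M - {\<omega> \<in> space M. S \<omega> \<inter> UNIV \<noteq> {}}))"
    by (auto simp: totalize_def)
  also have "\<dots> \<in> sets M" using G by auto
  finally show "{\<omega> \<in> space M. totalize (S \<omega>) \<inter> G \<noteq> {}} \<in> sets M" .
qed

text \<open>A real number \<open>r\<close> bounds \<open>h (u \<omega>) \<omega>\<close> from above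
  exactly when \<open>(u \<omega>, r)\<close> lies in the closed epigraph, that is, when this point
  is its own projection.\<close>

lemma convex_normal_integrand_measurable_comp:
  fixes h :: "real^'m \<Rightarrow> 'a \<Rightarrow> ereal"
  assumes h: "convex_normal_integrand M h" and u[measurable]: "u \<in> borel_measurable M"
  shows "(\<lambda>\<omega>. h (u \<omega>) \<omega>) \<in> borel_measurable M"
proof -
  define E where "E = (\<lambda>\<omega>. ereal_epigraph (\<lambda>x. h x \<omega>))"
  have E: "measurable_set_valued M E" "\<And>\<omega>. \<omega> \<in> space M \<Longrightarrow> closed (E \<omega>) \<and> convex (E \<omega>)"
    using h by (auto simp: convex_normal_integrand_def E_def)
  have ne: "{\<omega> \<in> space M. E \<omega> \<inter> UNIV \<noteq> {}} \<in> sets M"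
    using E(1) open_UNIV unfolding measurable_set_valued_def by blast
  have real: "{\<omega> \<in> space M. h (u \<omega>) \<omega> \<le> ereal r} \<in> sets M" for r
  proof -
    have [measurable]: "(\<lambda>\<omega>. closest_point (totalize (E \<omega>)) (u \<omega>, r)) \<in> borel_measurable M"
      by (rule borel_measurable_closest_point)
        (use E in \<open>auto simp: totalize_def intro!: measurable_set_valued_totalize[unfolded totalize_def]\<close>)
    \<comment> \<open>Where the epigraph is empty, \<open>totalize\<close> makes every point its own
      projection; the first set removes these scenarios.\<close>
    have "{\<omega> \<in> space M. h (u \<omega>) \<omega> \<le> ereal r} = {\<omega> \<in> space M. E \<omega> \<inter> UNIV \<noteq> {}} \<inter>
        {\<omega> \<in> space M. closest_point (totalize (E \<omega>)) (u \<omega>, r) = (u \<omega>, r)}"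
    proof -
      have "h (u \<omega>) \<omega> \<le> ereal r \<longleftrightarrow> E \<omega> \<noteq> {} \<and> closest_point (totalize (E \<omega>)) (u \<omega>, r) = (u \<omega>, r)"
        if "\<omega> \<in> space M" for \<omega>
      proof -
        have "h (u \<omega>) \<omega> \<le> ereal r \<longleftrightarrow> (u \<omega>, r) \<in> E \<omega>"
          by (simp add: E_def ereal_epigraph_def)
        then show ?thesis
          using E(2)[OF that] closest_point_refl[of "E \<omega>" "(u \<omega>, r)"]
          by (auto simp: totalize_def)
      qed
      then show ?thesis by auto
    qed
    also have "\<dots> \<in> sets M"
      using ne by (intro sets.Int) auto
    finally show ?thesis .
  qed
  show ?thesis
  proof (rule borel_measurableI_le)
    fix a :: ereal
    show "{\<omega> \<in> space M. h (u \<omega>) \<omega> \<le> a} \<in> sets M"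
    proof (cases a)
      case (real r)
      then show ?thesis using \<open>\<And>r. {\<omega> \<in> space M. h (u \<omega>) \<omega> \<le> ereal r} \<in> sets M\<close> by simp
    next
      case MInf
      have "{\<omega> \<in> space M. h (u \<omega>) \<omega> \<le> a} =
          {\<omega> \<in> space M. \<forall>n::nat. \<omega> \<in> {\<omega> \<in> space M. h (u \<omega>) \<omega> \<le> ereal (- real n)}}"
      proof (intro Collect_cong conj_cong refl)
        fix \<omega> assume "\<omega> \<in> space M"
        have "h (u \<omega>) \<omega> = - \<infinity>" if *: "\<forall>n::nat. h (u \<omega>) \<omega> \<le> ereal (- real n)"
        proof (rule ereal_bot)
          fix B :: real
          obtain n :: nat where "- B \<le> real n" using real_arch_simple by blast
          then show "h (u \<omega>) \<omega> \<le> ereal B" using *[rule_format, of n]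
            by (meson ereal_less_eq(3) minus_le_iff order_trans)
        qed
        then show "(h (u \<omega>) \<omega> \<le> a) \<longleftrightarrow>
            (\<forall>n::nat. \<omega> \<in> {\<omega> \<in> space M. h (u \<omega>) \<omega> \<le> ereal (- real n)})"
          using \<open>\<omega> \<in> space M\<close> MInf by auto
      qed
      also have "\<dots> \<in> sets M"
        using real by (intro sets.sets_Collect_countable_All) auto
      finally show ?thesis .
    qed simp
  qed
qed

section \<open>Extended integrals and the interchange rule\<close>

text \<open>\<open>nn_integral\<close> is monotone on arbitrary functions, so this applies to
  \<open>conjugate h\<close> along \<open>y\<close> as well, which is known to be measurable only up
  to a null set.\<close>

lemma ereal_integral_mono:
  assumes "AE \<omega> in M. f \<omega> \<le> g \<omega>"
  shows "ereal_integral M f \<le> ereal_integral M g"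
proof (cases "(\<integral>\<^sup>+\<omega>. e2ennreal (g \<omega>) \<partial>M) = \<infinity>")
  case False
  have pos: "(\<integral>\<^sup>+\<omega>. e2ennreal (f \<omega>) \<partial>M) \<le> (\<integral>\<^sup>+\<omega>. e2ennreal (g \<omega>) \<partial>M)"
    using assms by (intro nn_integral_mono_AE) (auto intro: e2ennreal_mono)
  have neg: "(\<integral>\<^sup>+\<omega>. e2ennreal (- g \<omega>) \<partial>M) \<le> (\<integral>\<^sup>+\<omega>. e2ennreal (- f \<omega>) \<partial>M)"
    using assms by (intro nn_integral_mono_AE) (auto elim!: eventually_mono intro!: e2ennreal_mono)
  show ?thesis
    using False pos neg
    by (auto simp: ereal_integral_def top_unique less_eq_ennreal.rep_eq[symmetric]
        intro!: ereal_minus_mono)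
qed (auto simp: ereal_integral_def)

lemma ereal_integral_eq_integral:
  assumes g: "integrable M g" and f: "AE \<omega> in M. f \<omega> = ereal (g \<omega>)"
  shows "ereal_integral M f = ereal (LINT \<omega>|M. g \<omega>)"
proof -
  have "(\<integral>\<^sup>+\<omega>. e2ennreal (f \<omega>) \<partial>M) = (\<integral>\<^sup>+\<omega>. ennreal (g \<omega>) \<partial>M)"
    using f by (intro nn_integral_cong_AE) (auto simp: ennreal.abs_eq e2ennreal_ereal)
  moreover have "(\<integral>\<^sup>+\<omega>. e2ennreal (- f \<omega>) \<partial>M) = (\<integral>\<^sup>+\<omega>. ennreal (- g \<omega>) \<partial>M)"
    using f by (intro nn_integral_cong_AE) (auto simp: ennreal.abs_eq e2ennreal_ereal)
  ultimately show ?thesis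
    using real_integrable_def[of M g] real_lebesgue_integral_def[OF g] g
    by (cases "\<integral>\<^sup>+\<omega>. ennreal (g \<omega>) \<partial>M"; cases "\<integral>\<^sup>+\<omega>. ennreal (- g \<omega>) \<partial>M")
      (auto simp: ereal_integral_def)
qed

text \<open>The measurable version \<open>f'\<close> is kept apart from \<open>f\<close> for the
  sake of \<open>conjugate h\<close>, which is only known to agree almost everywhere with a
  measurable function.\<close>

lemma ereal_integral_finite_imp_integrable:
  assumes f[measurable]: "f' \<in> borel_measurable M" and ff: "AE \<omega> in M. f \<omega> = f' \<omega>"
    and fin: "\<bar>ereal_integral M f\<bar> \<noteq> \<infinity>"
  obtains g where "integrable M g" "AE \<omega> in M. f \<omega> = ereal (g \<omega>)"
proof
  have *: "ereal_integral M f = ereal_integral M f'"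
    using ff by (intro antisym ereal_integral_mono) auto
  have P: "(\<integral>\<^sup>+\<omega>. e2ennreal (f' \<omega>) \<partial>M) \<noteq> \<infinity>"
    using fin unfolding * by (auto simp: ereal_integral_def)
  have N: "(\<integral>\<^sup>+\<omega>. e2ennreal (- f' \<omega>) \<partial>M) \<noteq> \<infinity>"
    using fin P unfolding *
    by (cases "\<integral>\<^sup>+\<omega>. e2ennreal (f' \<omega>) \<partial>M") (auto simp: ereal_integral_def)
  have fin': "AE \<omega> in M. \<bar>f' \<omega>\<bar> \<noteq> \<infinity>"
    using nn_integral_PInf_AE[OF _ P] nn_integral_PInf_AE[OF _ N]
    by (auto elim!: eventually_elim2)
  have P': "(\<integral>\<^sup>+\<omega>. e2ennreal (f' \<omega>) \<partial>M) = (\<integral>\<^sup>+\<omega>. ennreal (real_of_ereal (f' \<omega>)) \<partial>M)"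
    using fin' by (intro nn_integral_cong_AE) (auto elim!: eventually_mono simp: e2ennreal_ereal)
  have N': "(\<integral>\<^sup>+\<omega>. e2ennreal (- f' \<omega>) \<partial>M) = (\<integral>\<^sup>+\<omega>. ennreal (- real_of_ereal (f' \<omega>)) \<partial>M)"
    using fin' by (intro nn_integral_cong_AE) (auto elim!: eventually_mono simp: e2ennreal_ereal)
  show "integrable M (\<lambda>\<omega>. real_of_ereal (f' \<omega>))"
    using P N unfolding P' N' real_integrable_def by auto
  show "AE \<omega> in M. f \<omega> = ereal (real_of_ereal (f' \<omega>))"
    using fin' ff by eventually_elim (auto simp: ereal_real')
qed

text \<open>The sets \<open>A n\<close> shrink to a null set, so almost every point eventually
  leaves them for good; dominated convergence with bound \<open>norm (f \<omega>)\<close> does the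
  rest.\<close>

lemma (in finite_measure) set_integral_decseq_tendsto_0:
  fixes f :: "'a \<Rightarrow> real"
  assumes A: "\<And>n::nat. A n \<in> sets M" "decseq A" "(\<lambda>n. measure M (A n)) \<longlonglongrightarrow> 0"
    and f: "integrable M f"
  shows "(\<lambda>n. LINT \<omega>|M. indicat_real (A n) \<omega> * f \<omega>) \<longlonglongrightarrow> 0"
proof -
  have "(\<lambda>n. measure M (A n)) \<longlonglongrightarrow> measure M (\<Inter>n. A n)"
    using A by (intro finite_Lim_measure_decseq) auto
  then have "measure M (\<Inter>n. A n) = 0"
    using A(3) LIMSEQ_unique by blast
  then have "(\<Inter>n. A n) \<in> null_sets M"
    using A(1) by (intro null_setsI) (auto simp: emeasure_eq_measure)
  then have notin: "AE \<omega> in M. \<omega> \<notin> (\<Inter>n. A n)"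
    by (rule AE_not_in)
  have "(\<lambda>n. LINT \<omega>|M. indicat_real (A n) \<omega> * f \<omega>) \<longlonglongrightarrow> (LINT \<omega>|M. 0 * f \<omega>)"
  proof (rule integral_dominated_convergence)
    show "integrable M (\<lambda>\<omega>. norm (f \<omega>))" using f by simp
    show "AE \<omega> in M. (\<lambda>n. indicat_real (A n) \<omega> * f \<omega>) \<longlonglongrightarrow> 0 * f \<omega>"
      using notin
    proof eventually_elim
      case (elim \<omega>)
      then obtain N where "\<omega> \<notin> A N" by auto
      then have "\<omega> \<notin> A n" if "n \<ge> N" for n
        using A(2) that by (auto dest: decseqD)
      then have "\<forall>\<^sub>F n in sequentially. indicat_real (A n) \<omega> * f \<omega> = 0 * f \<omega>"
        by (auto simp: eventually_sequentially intro!: exI[of _ N])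
      then show ?case by (rule tendsto_eventually)
    qed
  qed (use f A in \<open>auto simp: indicator_def\<close>)
  then show ?thesis by simp
qed

lemma liminf_le_const:
  fixes c :: "'b::complete_linorder"
  assumes "\<And>n. X n \<le> c"
  shows "liminf X \<le> c"
proof -
  have "liminf X \<le> liminf (\<lambda>_. c)"
    using assms by (intro Liminf_mono always_eventually allI)
  also have "\<dots> = c" by (rule Liminf_const) simp
  finally show ?thesis .
qed

text \<open>The core of Rockafellar's interchange theorem. The selections \<open>x n\<close> need not lie in \<open>V\<close>;
  they are cut back to \<open>v0\<close> where they or \<open>r n\<close> are large, or worse than \<open>v0\<close>, and the cuts are
  removed by Fatou's lemma.\<close>

lemma (in prob_space) ereal_integral_le_of_selections:
  fixes V :: "('a \<Rightarrow> real^'m) set" and f :: "real^'m \<Rightarrow> 'a \<Rightarrow> ereal"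
  assumes V: "decomposable M V" "V \<subseteq> borel_measurable M"
    and w[measurable]: "w \<in> borel_measurable M"
    and vw: "\<And>v. v \<in> V \<Longrightarrow> integrable M (\<lambda>\<omega>. v \<omega> \<bullet> w \<omega>)"
    and v0: "v0 \<in> V" and g0: "integrable M g0" and fv0: "AE \<omega> in M. f (v0 \<omega>) \<omega> \<le> ereal (g0 \<omega>)"
    and x[measurable]: "\<And>n::nat. x n \<in> borel_measurable M"
    and r[measurable]: "\<And>n. r n \<in> borel_measurable M"
    and fx: "\<And>n. AE \<omega> in M. f (x n \<omega>) \<omega> \<le> ereal (r n \<omega>)"
    and \<gamma>: "AE \<omega> in M. \<gamma> \<omega> \<le> liminf (\<lambda>n. ereal (x n \<omega> \<bullet> w \<omega> - r n \<omega>))"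
    and C: "\<And>v. v \<in> V \<Longrightarrow> ereal (pairing M v w) - integral_functional M f v \<le> C"
  shows "ereal_integral M \<gamma> \<le> C"
proof -
  \<comment> \<open>A test function is used only through an integrable majorant \<open>g\<close> of
    \<open>f\<close> along it, which avoids any question about the measurability of \<open>f\<close>
    along \<open>v\<close>.\<close>
  have upper: "ereal (pairing M v w - (LINT \<omega>|M. g \<omega>)) \<le> C"
    if "v \<in> V" "integrable M g" "AE \<omega> in M. f (v \<omega>) \<omega> \<le> ereal (g \<omega>)" for v g
  proof -
    have "integral_functional M f v \<le> ereal_integral M (\<lambda>\<omega>. ereal (g \<omega>))"
      unfolding integral_functional_def using that by (intro ereal_integral_mono) auto
    also have "\<dots> = ereal (LINT \<omega>|M. g \<omega>)"
      using that by (intro ereal_integral_eq_integral) auto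
    finally have "ereal (pairing M v w) - ereal (LINT \<omega>|M. g \<omega>) \<le>
        ereal (pairing M v w) - integral_functional M f v"
      by (intro ereal_minus_mono) auto
    also have "\<dots> \<le> C" by (rule C[OF that(1)])
    finally show ?thesis by simp
  qed
  show ?thesis
  proof (cases C)
    case (real c)
    have [measurable]: "v0 \<in> borel_measurable M" "g0 \<in> borel_measurable M"
      using v0 V g0 by auto
    define q0 where "q0 \<omega> = v0 \<omega> \<bullet> w \<omega> - g0 \<omega>" for \<omega>
    define q where "q n \<omega> = x n \<omega> \<bullet> w \<omega> - r n \<omega>" for n \<omega>
    have [measurable]: "q0 \<in> borel_measurable M" "\<And>n. q n \<in> borel_measurable M"
      unfolding q0_def q_def by measurable
    have q0: "integrable M q0"
      unfolding q0_def using vw[OF v0] g0 by simp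
    \<comment> \<open>The room that \<open>C\<close> leaves above the base point \<open>v0\<close>.
      The gains \<open>\<delta> n\<close> over \<open>q0\<close> will be shown to integrate to at
      most \<open>B\<close>.\<close>
    define B where "B = c - (LINT \<omega>|M. q0 \<omega>)"
    define \<delta> where "\<delta> n \<omega> = max 0 (q n \<omega> - q0 \<omega>)" for n \<omega>
    have [measurable]: "\<And>n. \<delta> n \<in> borel_measurable M"
      unfolding \<delta>_def by measurable
    have B: "B \<ge> 0"
      using upper[OF v0 g0 fv0] vw[OF v0] g0
      by (simp add: B_def q0_def real pairing_def)
    have cut: "(\<integral>\<^sup>+\<omega>. ennreal (\<delta> n \<omega>) \<partial>M) \<le> ennreal B" for n
    proof -
      \<comment> \<open>On \<open>A k\<close> the selection is bounded, as decomposability requires,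
        the bound on \<open>r n\<close> keeps the majorant integrable, and
        \<open>q0 \<le> q n\<close> makes the switch from \<open>v0\<close> to \<open>x n\<close> a
        gain of exactly \<open>\<delta> n\<close>.\<close>
      define A where "A k = {\<omega> \<in> space M. norm (x n \<omega>) \<le> real k \<and> \<bar>r n \<omega>\<bar> \<le> real k \<and> q0 \<omega> \<le> q n \<omega>}"
        for k :: nat
      have A[measurable]: "A k \<in> sets M" for k
        unfolding A_def by measurable
      have le: "(\<integral>\<^sup>+\<omega>. ennreal (indicat_real (A k) \<omega> * \<delta> n \<omega>) \<partial>M) \<le> ennreal B" for k
      proof -
        define v where "v = (\<lambda>\<omega>. if \<omega> \<in> space M - A k then v0 \<omega> else indicat_real (A k) \<omega> *\<^sub>R x n \<omega>)"
        define g where "g = (\<lambda>\<omega>. g0 \<omega> + indicat_real (A k) \<omega> * (r n \<omega> - g0 \<omega>))"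
        have "\<exists>C. AE \<omega> in M. norm (indicat_real (A k) \<omega> *\<^sub>R x n \<omega>) \<le> C"
          by (intro exI[of _ "real k"] AE_I2) (auto simp: indicator_def A_def)
        then have v: "v \<in> V"
          unfolding v_def
          by (intro V(1)[unfolded decomposable_def, rule_format, OF v0]) measurable
        have "integrable M (\<lambda>\<omega>. indicat_real (A k) \<omega> * r n \<omega>)"
          by (rule integrable_const_bound[of _ "real k"]) (auto simp: indicator_def A_def)
        moreover have "integrable M (\<lambda>\<omega>. indicat_real (A k) \<omega> * g0 \<omega>)"
          using integrable_mult_indicator[OF A g0] by simp
        ultimately have g: "integrable M g"
          unfolding g_def using g0 by (simp add: right_diff_distrib)
        have fv: "AE \<omega> in M. f (v \<omega>) \<omega> \<le> ereal (g \<omega>)"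
          using fv0 fx[of n] AE_space by eventually_elim (auto simp: v_def g_def indicator_def)
        have eq: "v \<omega> \<bullet> w \<omega> - g \<omega> = q0 \<omega> + indicat_real (A k) \<omega> * \<delta> n \<omega>" if "\<omega> \<in> space M" for \<omega>
          using that by (auto simp: v_def g_def q0_def q_def \<delta>_def indicator_def A_def)
        have "integrable M (\<lambda>\<omega>. (v \<omega> \<bullet> w \<omega> - g \<omega>) - q0 \<omega>)"
          using vw[OF v] g q0 by simp
        then have int: "integrable M (\<lambda>\<omega>. indicat_real (A k) \<omega> * \<delta> n \<omega>)"
          by (rule Bochner_Integration.integrable_cong[OF refl, THEN iffD1, rotated]) (simp add: eq)
        have "(LINT \<omega>|M. v \<omega> \<bullet> w \<omega> - g \<omega>) = (LINT \<omega>|M. q0 \<omega> + indicat_real (A k) \<omega> * \<delta> n \<omega>)"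
          by (intro Bochner_Integration.integral_cong refl eq)
        then have "(LINT \<omega>|M. indicat_real (A k) \<omega> * \<delta> n \<omega>) \<le> B"
          using upper[OF v g fv] vw[OF v] g q0 int by (simp add: B_def real pairing_def)
        then show ?thesis
          using int by (subst nn_integral_eq_integral) (auto simp: \<delta>_def intro: ennreal_leI)
      qed
      \<comment> \<open>Each point with \<open>q0 \<le> q n\<close> lies in all \<open>A k\<close>
        with \<open>k\<close> large, and elsewhere \<open>\<delta> n\<close> vanishes; so Fatou
        removes the cut.\<close>
      have "ennreal (\<delta> n \<omega>) \<le> liminf (\<lambda>k. ennreal (indicat_real (A k) \<omega> * \<delta> n \<omega>))"
        if "\<omega> \<in> space M" for \<omega>
      proof (rule Liminf_bounded)
        obtain K :: nat where K: "norm (x n \<omega>) + \<bar>r n \<omega>\<bar> \<le> real K"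
          using real_arch_simple by blast
        have "ennreal (\<delta> n \<omega>) \<le> ennreal (indicat_real (A k) \<omega> * \<delta> n \<omega>)" if "k \<ge> K" for k
        proof -
          have "norm (x n \<omega>) \<le> real k" "\<bar>r n \<omega>\<bar> \<le> real k"
            using K that norm_ge_zero[of "x n \<omega>"] abs_ge_zero[of "r n \<omega>"]
            by (smt (verit) of_nat_mono)+
          then show ?thesis
            using \<open>\<omega> \<in> space M\<close> by (auto simp: A_def \<delta>_def indicator_def)
        qed
        then show "\<forall>\<^sub>F k in sequentially. ennreal (\<delta> n \<omega>) \<le> ennreal (indicat_real (A k) \<omega> * \<delta> n \<omega>)"
          by (auto simp: eventually_sequentially)
      qed
      then have "(\<integral>\<^sup>+\<omega>. ennreal (\<delta> n \<omega>) \<partial>M) \<le>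
          (\<integral>\<^sup>+\<omega>. liminf (\<lambda>k. ennreal (indicat_real (A k) \<omega> * \<delta> n \<omega>)) \<partial>M)"
        by (intro nn_integral_mono)
      also have "\<dots> \<le> liminf (\<lambda>k. \<integral>\<^sup>+\<omega>. ennreal (indicat_real (A k) \<omega> * \<delta> n \<omega>) \<partial>M)"
        by (intro nn_integral_liminf) measurable
      also have "\<dots> \<le> ennreal B"
        using le by (rule liminf_le_const)
      finally show ?thesis .
    qed
    \<comment> \<open>Second use of Fatou, now over the index of the selections; the bound
      \<open>B\<close> does not depend on that index.\<close>
    define D where "D \<omega> = liminf (\<lambda>n. ennreal (\<delta> n \<omega>))" for \<omega>
    have [measurable]: "D \<in> borel_measurable M"
      unfolding D_def by measurable
    have "(\<integral>\<^sup>+\<omega>. D \<omega> \<partial>M) \<le> liminf (\<lambda>n. \<integral>\<^sup>+\<omega>. ennreal (\<delta> n \<omega>) \<partial>M)"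
      unfolding D_def by (intro nn_integral_liminf) measurable
    also have "\<dots> \<le> ennreal B"
      using cut by (rule liminf_le_const)
    finally have DB: "(\<integral>\<^sup>+\<omega>. D \<omega> \<partial>M) \<le> ennreal B" .
    then have "(\<integral>\<^sup>+\<omega>. D \<omega> \<partial>M) \<noteq> \<infinity>"
      by (metis ennreal_less_top infinity_ennreal_def leD)
    then have D_fin: "AE \<omega> in M. D \<omega> \<noteq> \<infinity>"
      by (intro nn_integral_PInf_AE) auto
    define d where "d \<omega> = enn2real (D \<omega>)" for \<omega>
    have [measurable]: "d \<in> borel_measurable M"
      unfolding d_def by measurable
    have d0: "0 \<le> d \<omega>" for \<omega>
      by (simp add: d_def)
    have D_eq: "AE \<omega> in M. D \<omega> = ennreal (d \<omega>)"
      using D_fin by eventually_elim (auto simp: d_def less_top)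
    have dB: "(\<integral>\<^sup>+\<omega>. ennreal (d \<omega>) \<partial>M) \<le> ennreal B"
      using DB nn_integral_cong_AE[OF D_eq] by simp
    have d: "integrable M d"
      by (rule integrableI_nonneg)
        (use dB in \<open>auto simp: d_def intro: le_less_trans[OF _ ennreal_less_top]\<close>)
    have "ennreal (LINT \<omega>|M. d \<omega>) \<le> ennreal B"
      using dB nn_integral_eq_integral[OF d] d0 by simp
    then have "(LINT \<omega>|M. d \<omega>) \<le> B"
      using B by simp
    \<comment> \<open>Since \<open>q n \<le> q0 + \<delta> n\<close>, the liminf of
      \<open>q n\<close> is at most \<open>q0 + d\<close>. A real \<open>e\<close> strictly in
      between carries the argument, so that no liminf in \<open>ereal\<close> is added to one in
      \<open>ennreal\<close>.\<close>
    have "AE \<omega> in M. \<gamma> \<omega> \<le> ereal (q0 \<omega> + d \<omega>)"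
      using \<gamma> D_eq
    proof eventually_elim
      case (elim \<omega>)
      show ?case
      proof (rule ccontr)
        assume "\<not> ?case"
        then obtain e where e: "q0 \<omega> + d \<omega> < e" "ereal e < \<gamma> \<omega>"
          using ereal_dense2[of "ereal (q0 \<omega> + d \<omega>)" "\<gamma> \<omega>"] by (auto simp: not_le)
        have "ereal e < liminf (\<lambda>n. ereal (q n \<omega>))"
          using e(2) elim(1) by (simp add: q_def)
        then have "\<forall>\<^sub>F n in sequentially. ereal e < ereal (q n \<omega>)"
          by (rule less_LiminfD)
        then have "\<forall>\<^sub>F n in sequentially. ennreal (e - q0 \<omega>) \<le> ennreal (\<delta> n \<omega>)"
          by eventually_elim (auto simp: \<delta>_def intro!: ennreal_leI)
        then have "ennreal (e - q0 \<omega>) \<le> D \<omega>"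
          unfolding D_def by (rule Liminf_bounded)
        then show False
          using e(1) elim(2) d0[of \<omega>] by simp
      qed
    qed
    then have "ereal_integral M \<gamma> \<le> ereal_integral M (\<lambda>\<omega>. ereal (q0 \<omega> + d \<omega>))"
      by (rule ereal_integral_mono)
    also have "\<dots> = ereal (LINT \<omega>|M. q0 \<omega> + d \<omega>)"
      using q0 d by (intro ereal_integral_eq_integral) auto
    also have "\<dots> \<le> C"
      using q0 d \<open>(LINT \<omega>|M. d \<omega>) \<le> B\<close> by (simp add: B_def real)
    finally show ?thesis .
  next
    case PInf
    then show ?thesis by simp
  next
    case MInf
    then show ?thesis using upper[OF v0 g0 fv0] by simp
  qed
qed

section \<open>The Hahn--Banach theorem\<close>

lemma linear_spaceD:
  assumes "linear_space U" "u \<in> U" "v \<in> U"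
  shows linear_space_combine: "(\<lambda>\<omega>. a *\<^sub>R u \<omega> + b *\<^sub>R v \<omega>) \<in> U"
    and linear_space_add: "(\<lambda>\<omega>. u \<omega> + v \<omega>) \<in> U"
    and linear_space_diff: "(\<lambda>\<omega>. u \<omega> - v \<omega>) \<in> U"
    and linear_space_scale: "(\<lambda>\<omega>. a *\<^sub>R u \<omega>) \<in> U"
    and linear_space_minus: "(\<lambda>\<omega>. - u \<omega>) \<in> U"
proof -
  have *: "(\<lambda>\<omega>. a *\<^sub>R u \<omega> + b *\<^sub>R v \<omega>) \<in> U" for a b
    using assms unfolding linear_space_def by blast
  show "(\<lambda>\<omega>. a *\<^sub>R u \<omega> + b *\<^sub>R v \<omega>) \<in> U" by (rule *)
  show "(\<lambda>\<omega>. u \<omega> + v \<omega>) \<in> U" using *[of 1 1] by simp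
  show "(\<lambda>\<omega>. u \<omega> - v \<omega>) \<in> U" using *[of 1 "-1"] by simp
  show "(\<lambda>\<omega>. a *\<^sub>R u \<omega>) \<in> U" using *[of a 0] by simp
  show "(\<lambda>\<omega>. - u \<omega>) \<in> U" using *[of "-1" 0] by simp
qed

text \<open>Homogeneity is demanded only as an inequality, the form that an infimum inherits
  directly; equality returns by scaling with \<open>inverse t\<close>.\<close>

definition sublinear_on :: "('a \<Rightarrow> 'v::real_vector) set \<Rightarrow> (('a \<Rightarrow> 'v) \<Rightarrow> real) \<Rightarrow> bool" where
  "sublinear_on U q \<longleftrightarrow>
     (\<forall>u\<in>U. \<forall>v\<in>U. q (\<lambda>\<omega>. u \<omega> + v \<omega>) \<le> q u + q v) \<and>
     (\<forall>u\<in>U. \<forall>t>0. q (\<lambda>\<omega>. t *\<^sub>R u \<omega>) \<le> t * q u)"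

lemma sublinear_onD:
  assumes "sublinear_on U q" "u \<in> U"
  shows sublinear_on_add: "v \<in> U \<Longrightarrow> q (\<lambda>\<omega>. u \<omega> + v \<omega>) \<le> q u + q v"
    and sublinear_on_scale_le: "t > 0 \<Longrightarrow> q (\<lambda>\<omega>. t *\<^sub>R u \<omega>) \<le> t * q u"
  using assms unfolding sublinear_on_def by blast+

lemma sublinear_on_scale:
  assumes "linear_space U" "sublinear_on U q" "u \<in> U" "t > 0"
  shows "q (\<lambda>\<omega>. t *\<^sub>R u \<omega>) = t * q u"
proof (rule antisym)
  show "q (\<lambda>\<omega>. t *\<^sub>R u \<omega>) \<le> t * q u"
    using assms by (intro sublinear_on_scale_le)
  have "q (\<lambda>\<omega>. inverse t *\<^sub>R (t *\<^sub>R u \<omega>)) \<le> inverse t * q (\<lambda>\<omega>. t *\<^sub>R u \<omega>)"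
    using assms linear_space_scale by (intro sublinear_on_scale_le[OF assms(2)]) auto
  then show "t * q u \<le> q (\<lambda>\<omega>. t *\<^sub>R u \<omega>)"
    using assms(4) by (simp add: field_simps)
qed

lemma sublinear_on_zero:
  assumes "linear_space U" "sublinear_on U q"
  shows "q (\<lambda>\<omega>. 0) = 0"
proof -
  have "(\<lambda>\<omega>. 0) \<in> U" using assms by (simp add: linear_space_def)
  from sublinear_on_scale[OF assms this, of 2] show ?thesis by simp
qed

lemma sublinear_on_minus_le:
  assumes "linear_space U" "sublinear_on U q" "u \<in> U"
  shows "- q (\<lambda>\<omega>. - u \<omega>) \<le> q u"
  using sublinear_on_add[OF assms(2,3), of "\<lambda>\<omega>. - u \<omega>"] linear_space_minus[OF assms(1,3,3)]
    sublinear_on_zero[OF assms(1,2)] by simp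

text \<open>Common pattern of three constructions: perturbing along one direction, taking the
  infimum of a chain, and inf-convolution. The index \<open>k\<close> may differ from the given
  ones, and boundedness below is what makes the real infimum meaningful.\<close>

lemma sublinear_on_INF:
  fixes Q :: "('b \<Rightarrow> ('a \<Rightarrow> 'v::real_vector) \<Rightarrow> real)"
  assumes U: "linear_space U" and I: "I \<noteq> {}"
    and bdd: "\<And>u. u \<in> U \<Longrightarrow> bdd_below ((\<lambda>i. Q i u) ` I)"
    and add: "\<And>u v i j. u \<in> U \<Longrightarrow> v \<in> U \<Longrightarrow> i \<in> I \<Longrightarrow> j \<in> I \<Longrightarrow>
      \<exists>k\<in>I. Q k (\<lambda>\<omega>. u \<omega> + v \<omega>) \<le> Q i u + Q j v"
    and scale: "\<And>u i t. u \<in> U \<Longrightarrow> i \<in> I \<Longrightarrow> t > 0 \<Longrightarrow> \<exists>k\<in>I. Q k (\<lambda>\<omega>. t *\<^sub>R u \<omega>) \<le> t * Q i u"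
    and eq: "\<And>u. u \<in> U \<Longrightarrow> q u = (INF i\<in>I. Q i u)"
  shows "sublinear_on U q"
proof -
  have lower: "q u \<le> Q i u" if "u \<in> U" "i \<in> I" for u i
    using that bdd by (auto simp: eq intro: cINF_lower)
  have greatest: "c \<le> q u" if "u \<in> U" "\<And>i. i \<in> I \<Longrightarrow> c \<le> Q i u" for u c
    using that I by (auto simp: eq intro: cINF_greatest)
  show ?thesis
    unfolding sublinear_on_def
  proof (intro conjI ballI allI impI)
    fix u v assume u: "u \<in> U" and v: "v \<in> U"
    have uv: "(\<lambda>\<omega>. u \<omega> + v \<omega>) \<in> U" using U u v by (rule linear_space_add)
    have "q (\<lambda>\<omega>. u \<omega> + v \<omega>) \<le> Q i u + Q j v" if "i \<in> I" "j \<in> I" for i j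
      using add[OF u v that] lower[OF uv] by (meson order_trans)
    then have "q (\<lambda>\<omega>. u \<omega> + v \<omega>) - Q i u \<le> q v" if "i \<in> I" for i
      using that by (intro greatest[OF v]) (simp add: diff_le_eq add.commute[of "Q _ v"])
    then have "q (\<lambda>\<omega>. u \<omega> + v \<omega>) - q v \<le> q u"
      by (intro greatest[OF u]) (simp add: diff_le_eq add.commute)
    then show "q (\<lambda>\<omega>. u \<omega> + v \<omega>) \<le> q u + q v" by simp
  next
    fix u and t :: real assume u: "u \<in> U" and t: "0 < t"
    have tu: "(\<lambda>\<omega>. t *\<^sub>R u \<omega>) \<in> U" using U u u by (rule linear_space_scale)
    have "q (\<lambda>\<omega>. t *\<^sub>R u \<omega>) \<le> t * Q i u" if "i \<in> I" for i
      using scale[OF u that t] lower[OF tu] by (meson order_trans)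
    then have "q (\<lambda>\<omega>. t *\<^sub>R u \<omega>) / t \<le> q u"
      using t by (intro greatest[OF u]) (simp add: field_simps)
    then show "q (\<lambda>\<omega>. t *\<^sub>R u \<omega>) \<le> t * q u" using t by (simp add: field_simps)
  qed
qed

text \<open>A minimal sublinear functional \<open>q\<close> is linear, because
  \<open>u \<mapsto> inf\<^sub>t\<^sub>\<ge>\<^sub>0 (q (u + t v) - t q v)\<close> is a sublinear functional below \<open>q\<close>.\<close>

lemma minimal_sublinear_additive:
  fixes U :: "('a \<Rightarrow> 'v::real_vector) set"
  assumes U: "linear_space U" and q: "sublinear_on U q"
    and min: "\<And>q'. sublinear_on U q' \<Longrightarrow> \<forall>u\<in>U. q' u \<le> q u \<Longrightarrow> \<forall>u\<in>U. q' u = q u"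
    and u: "u \<in> U" and v: "v \<in> U"
  shows "q (\<lambda>\<omega>. u \<omega> + v \<omega>) = q u + q v"
proof -
  define Q where "Q t u = q (\<lambda>\<omega>. u \<omega> + t *\<^sub>R v \<omega>) - t * q v" for t u
  have tv: "(\<lambda>\<omega>. t *\<^sub>R v \<omega>) \<in> U" for t
    using U v v by (rule linear_space_scale)
  have utv: "(\<lambda>\<omega>. u \<omega> + t *\<^sub>R v \<omega>) \<in> U" if "u \<in> U" for u t
    using U that tv by (rule linear_space_add)
  have scale_v: "q (\<lambda>\<omega>. t *\<^sub>R v \<omega>) = t * q v" if "t \<ge> 0" for t
    using that sublinear_on_scale[OF U q v, of t] sublinear_on_zero[OF U q]
    by (cases "t = 0") auto
  have below: "- q (\<lambda>\<omega>. - u \<omega>) \<le> Q t u" if "u \<in> U" "t \<in> {0..}" for u t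
  proof -
    have "q (\<lambda>\<omega>. (u \<omega> + t *\<^sub>R v \<omega>) + - u \<omega>) \<le> q (\<lambda>\<omega>. u \<omega> + t *\<^sub>R v \<omega>) + q (\<lambda>\<omega>. - u \<omega>)"
      using q utv[OF that(1)] linear_space_minus[OF U that(1,1)] by (rule sublinear_on_add)
    then show ?thesis using scale_v that by (simp add: Q_def)
  qed
  have bdd: "bdd_below ((\<lambda>t. Q t u) ` {0..})" if "u \<in> U" for u
    using below[OF that] by (intro bdd_belowI2)
  have "sublinear_on U (\<lambda>u. INF t\<in>{0..}. Q t u)"
  proof (rule sublinear_on_INF[OF U, where I = "{0..}" and Q = Q])
    fix u1 u2 and s t :: real assume *: "u1 \<in> U" "u2 \<in> U" "s \<in> {0..}" "t \<in> {0..}"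
    have "q (\<lambda>\<omega>. (u1 \<omega> + s *\<^sub>R v \<omega>) + (u2 \<omega> + t *\<^sub>R v \<omega>)) \<le>
        q (\<lambda>\<omega>. u1 \<omega> + s *\<^sub>R v \<omega>) + q (\<lambda>\<omega>. u2 \<omega> + t *\<^sub>R v \<omega>)"
      using * by (intro sublinear_on_add[OF q] utv)
    also have "(\<lambda>\<omega>. (u1 \<omega> + s *\<^sub>R v \<omega>) + (u2 \<omega> + t *\<^sub>R v \<omega>)) =
        (\<lambda>\<omega>. (u1 \<omega> + u2 \<omega>) + (s + t) *\<^sub>R v \<omega>)"
      by (simp add: algebra_simps)
    finally have "Q (s + t) (\<lambda>\<omega>. u1 \<omega> + u2 \<omega>) \<le> Q s u1 + Q t u2"
      by (simp add: Q_def algebra_simps)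
    then show "\<exists>k\<in>{0..}. Q k (\<lambda>\<omega>. u1 \<omega> + u2 \<omega>) \<le> Q s u1 + Q t u2"
      using * by (intro bexI[of _ "s + t"]) auto
  next
    fix u1 and s t :: real assume *: "u1 \<in> U" "s \<in> {0..}" "0 < t"
    have "q (\<lambda>\<omega>. t *\<^sub>R (u1 \<omega> + s *\<^sub>R v \<omega>)) \<le> t * q (\<lambda>\<omega>. u1 \<omega> + s *\<^sub>R v \<omega>)"
      using * by (intro sublinear_on_scale_le[OF q] utv)
    then have "Q (t * s) (\<lambda>\<omega>. t *\<^sub>R u1 \<omega>) \<le> t * Q s u1"
      by (simp add: Q_def algebra_simps)
    then show "\<exists>k\<in>{0..}. Q k (\<lambda>\<omega>. t *\<^sub>R u1 \<omega>) \<le> t * Q s u1"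
      using * by (intro bexI[of _ "t * s"]) auto
  qed (use bdd in auto)
  moreover have "\<forall>u\<in>U. (INF t\<in>{0..}. Q t u) \<le> q u"
  proof
    fix u assume "u \<in> U"
    then have "(INF t\<in>{0..}. Q t u) \<le> Q 0 u" by (intro cINF_lower bdd) auto
    then show "(INF t\<in>{0..}. Q t u) \<le> q u" by (simp add: Q_def)
  qed
  ultimately have "q u = (INF t\<in>{0..}. Q t u)"
    using u by (metis (no_types, lifting) min)
  \<comment> \<open>The index 1 gives \<open>q u + q v\<close> as a lower bound of \<open>q\<close>
    at the sum; the reverse inequality is subadditivity.\<close>
  also have "\<dots> \<le> Q 1 u"
    by (intro cINF_lower bdd u) auto
  finally show ?thesis
    using sublinear_on_add[OF q u v] by (simp add: Q_def)
qed

text \<open>Zorn's lemma yields a minimal sublinear functional below \<open>p\<close>, and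
  minimality forces it to be additive, hence linear. This gives a dominated linear functional
  directly, with no extension from a subspace.\<close>

theorem Hahn_Banach_sublinear:
  fixes U :: "('a \<Rightarrow> 'v::real_vector) set"
  assumes U: "linear_space U" and p: "sublinear_on U p"
  obtains l where "\<And>u v a b. u \<in> U \<Longrightarrow> v \<in> U \<Longrightarrow> l (\<lambda>\<omega>. a *\<^sub>R u \<omega> + b *\<^sub>R v \<omega>) = a * l u + b * l v"
    and "\<And>u. u \<in> U \<Longrightarrow> l u \<le> p u"
proof -
  \<comment> \<open>Functionals are compared only on \<open>U\<close>; \<open>extensional U\<close>
    makes the resulting order antisymmetric.\<close>
  define A where "A = {q \<in> extensional U. sublinear_on U q \<and> (\<forall>u\<in>U. q u \<le> p u)}"
  \<comment> \<open>The order is reversed, so that the maximal element of Zorn's lemma is a minimal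
    functional.\<close>
  define r where "r = {(q, q'). q \<in> A \<and> q' \<in> A \<and> (\<forall>u\<in>U. q' u \<le> q u)}"
  have sub_restrict: "sublinear_on U (restrict q U) \<longleftrightarrow> sublinear_on U q" for q
    using linear_space_add[OF U] linear_space_scale[OF U] by (auto simp: sublinear_on_def)
  have Field: "Field r = A"
    by (auto simp: r_def Field_def)
  have "Partial_order r"
    unfolding partial_order_on_def preorder_on_def Field
  proof (intro conjI)
    show "antisym r"
      by (auto simp: antisym_def r_def A_def) (metis extensionalityI order_antisym)
    show "trans r"
      by (auto simp: trans_def r_def) (meson order_trans)
  qed (auto simp: refl_on_def r_def)
  moreover have "\<exists>u\<in>Field r. \<forall>a\<in>C. (a, u) \<in> r" if C: "C \<in> Chains r" for C
  proof (cases "C = {}")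
    case True
    have "restrict p U \<in> A"
      using p sub_restrict by (auto simp: A_def)
    then show ?thesis using True Field by auto
  next
    case False
    have CA: "C \<subseteq> A"
      using C by (force simp: Chains_def r_def)
    define m where "m = (\<lambda>u\<in>U. INF q\<in>C. q u)"
    \<comment> \<open>A bound that is uniform over all sublinear functionals below \<open>p\<close>;
      it keeps the infimum of the chain finite.\<close>
    have below: "- p (\<lambda>\<omega>. - u \<omega>) \<le> q u" if "u \<in> U" "q \<in> C" for u q
    proof -
      have "sublinear_on U q" "q (\<lambda>\<omega>. - u \<omega>) \<le> p (\<lambda>\<omega>. - u \<omega>)"
        using that CA linear_space_minus[OF U that(1,1)] by (auto simp: A_def)
      then show ?thesis using sublinear_on_minus_le[OF U _ that(1), of q] by simp
    qed
    have bdd: "bdd_below ((\<lambda>q. q u) ` C)" if "u \<in> U" for u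
      using below[OF that] by (intro bdd_belowI2)
    have "sublinear_on U m"
    proof (rule sublinear_on_INF[OF U False, where Q = "\<lambda>q. q"])
      fix u v q q' assume *: "u \<in> U" "v \<in> U" "q \<in> C" "q' \<in> C"
      then have "(q, q') \<in> r \<or> (q', q) \<in> r" using C by (auto simp: Chains_def)
      then obtain k where k: "k \<in> C" "\<forall>u\<in>U. k u \<le> q u \<and> k u \<le> q' u"
        using * by (auto simp: r_def)
      have "k (\<lambda>\<omega>. u \<omega> + v \<omega>) \<le> k u + k v"
        using k(1) CA * by (auto simp: A_def intro: sublinear_on_add)
      also have "\<dots> \<le> q u + q' v" using k(2) * by (intro add_mono) auto
      finally show "\<exists>k\<in>C. k (\<lambda>\<omega>. u \<omega> + v \<omega>) \<le> q u + q' v" using k(1) by blast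
    next
      fix u q and t :: real assume *: "u \<in> U" "q \<in> C" "0 < t"
      then show "\<exists>k\<in>C. k (\<lambda>\<omega>. t *\<^sub>R u \<omega>) \<le> t * q u"
        using CA by (intro bexI[of _ q]) (auto simp: A_def intro: sublinear_on_scale_le)
    qed (use bdd in \<open>auto simp: m_def\<close>)
    moreover have le: "m u \<le> q u" if "q \<in> C" "u \<in> U" for q u
      using that bdd by (auto simp: m_def intro: cINF_lower)
    moreover have "m u \<le> p u" if "u \<in> U" for u
    proof -
      obtain q where "q \<in> C" using False by blast
      then show ?thesis using le[of q u] that CA by (force simp: A_def)
    qed
    ultimately have "m \<in> A" by (auto simp: A_def m_def)
    then show ?thesis
      using le CA unfolding Field by (intro bexI[of _ m]) (auto simp: r_def)
  qed
  ultimately obtain q where q: "q \<in> A" and qmin: "\<And>q'. q' \<in> A \<Longrightarrow> (q, q') \<in> r \<Longrightarrow> q' = q"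
    using Zorns_po_lemma[of r] unfolding Field by blast
  have qs: "sublinear_on U q" using q by (simp add: A_def)
  have add: "q (\<lambda>\<omega>. u \<omega> + v \<omega>) = q u + q v" if "u \<in> U" "v \<in> U" for u v
  proof (rule minimal_sublinear_additive[OF U qs _ that])
    fix q' assume *: "sublinear_on U q'" "\<forall>u\<in>U. q' u \<le> q u"
    then have "restrict q' U \<in> A"
      using q sub_restrict by (fastforce simp: A_def)
    then have "restrict q' U = q"
      using * q by (intro qmin) (auto simp: r_def)
    then show "\<forall>u\<in>U. q' u = q u" by auto
  qed
  have scale: "q (\<lambda>\<omega>. a *\<^sub>R u \<omega>) = a * q u" if "u \<in> U" for a u
  proof -
    have pos: "q (\<lambda>\<omega>. t *\<^sub>R u \<omega>) = t * q u" if "t > 0" for t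
      using U qs \<open>u \<in> U\<close> that by (rule sublinear_on_scale)
    consider "a > 0" | "a = 0" | "a < 0" by linarith
    then show ?thesis
    proof cases
      case 3
      have "q (\<lambda>\<omega>. a *\<^sub>R u \<omega> + (- a) *\<^sub>R u \<omega>) = q (\<lambda>\<omega>. a *\<^sub>R u \<omega>) + q (\<lambda>\<omega>. (- a) *\<^sub>R u \<omega>)"
        using linear_space_scale[OF U that that] by (intro add)
      then show ?thesis
        using pos[of "- a"] 3 sublinear_on_zero[OF U qs] by simp
    qed (use pos sublinear_on_zero[OF U qs] in auto)
  qed
  show thesis
  proof
    fix u v a b assume "u \<in> U" "v \<in> U"
    then show "q (\<lambda>\<omega>. a *\<^sub>R u \<omega> + b *\<^sub>R v \<omega>) = a * q u + b * q v"
      using add[OF linear_space_scale[OF U] linear_space_scale[OF U]] scale by simp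
  qed (use q in \<open>auto simp: A_def\<close>)
qed

section \<open>Pointwise conjugates\<close>

text \<open>Were \<open>f x\<close> equal to minus infinity, the segment from \<open>(a, c)\<close>
  to a point over \<open>x\<close> at depth \<open>Suc n\<close> below \<open>c\<close>, taken at
  fraction \<open>1 / Suc n\<close>, would pass at height exactly \<open>c - 1\<close>. These points
  converge to \<open>(a, c - 1)\<close>, and closedness contradicts \<open>f a = c\<close>.\<close>

lemma closed_convex_epigraph_not_MInf:
  fixes f :: "'v::real_normed_vector \<Rightarrow> ereal"
  assumes E: "closed (ereal_epigraph f)" "convex (ereal_epigraph f)" and a: "\<bar>f a\<bar> \<noteq> \<infinity>"
  shows "f x \<noteq> - \<infinity>"
proof
  assume x: "f x = - \<infinity>"
  obtain c where c: "f a = ereal c" using a by auto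
  have inE: "(a + (1 / real (Suc n)) *\<^sub>R (x - a), c - 1) \<in> ereal_epigraph f" for n
  proof -
    have "(1 - 1 / real (Suc n)) *\<^sub>R (a, c) + (1 / real (Suc n)) *\<^sub>R (x, c - real (Suc n)) \<in> ereal_epigraph f"
      using c x by (intro convexD_alt[OF E(2)]) (auto simp: ereal_epigraph_def)
    also have "(1 - 1 / real (Suc n)) *\<^sub>R (a, c) + (1 / real (Suc n)) *\<^sub>R (x, c - real (Suc n)) =
        (a + (1 / real (Suc n)) *\<^sub>R (x - a), c - 1)"
      by (simp add: algebra_simps del: of_nat_Suc) (simp add: field_simps)
    finally show ?thesis .
  qed
  have "(\<lambda>n. (a + (1 / real (Suc n)) *\<^sub>R (x - a), c - 1)) \<longlonglongrightarrow> (a + 0 *\<^sub>R (x - a), c - 1)"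
    using LIMSEQ_inverse_real_of_nat by (intro tendsto_intros) (simp add: inverse_eq_divide)
  then have "(a + 0 *\<^sub>R (x - a), c - 1) \<in> ereal_epigraph f"
    by (rule closed_sequentially[OF E(1) inE])
  then show False using c by (simp add: ereal_epigraph_def)
qed

lemma conjugate_upper: "ereal (x \<bullet> y) - h x \<omega> \<le> conjugate h y \<omega>"
  unfolding conjugate_def by (rule SUP_upper) simp

text \<open>Projecting \<open>n c\<close> onto \<open>S\<close> yields approximate maximizers of the linear form \<open>c\<close> over \<open>S\<close>;
  in this way measurable selections come from projections alone.\<close>

lemma inner_closest_point_ge:
  fixes S :: "'b::euclidean_space set"
  assumes S: "closed S" "convex S" and s: "s \<in> S" and n: "n > 0"
  shows "c \<bullet> s - (norm s)\<^sup>2 / (4 * n) \<le> c \<bullet> closest_point S (n *\<^sub>R c)"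
proof -
  define p where "p = closest_point S (n *\<^sub>R c)"
  have "(n *\<^sub>R c - p) \<bullet> (s - p) \<le> 0"
    unfolding p_def using S s by (intro closest_point_dot)
  \<comment> \<open>The variational inequality leaves the error
    \<open>p \<bullet> s - p \<bullet> p\<close>; completing the square bounds it by a quarter of
    the squared norm of \<open>s\<close>, whence the 4.\<close>
  moreover have "0 \<le> (norm (p - (1/2) *\<^sub>R s))\<^sup>2" by simp
  ultimately have "n * (c \<bullet> s) - (norm s)\<^sup>2 / 4 \<le> n * (c \<bullet> p)"
    unfolding power2_norm_eq_inner by (simp add: algebra_simps inner_commute)
  then show ?thesis
    using n by (simp add: p_def field_simps)
qed

text \<open>The conjugate at \<open>w\<close> is the support function of the epigraph in direction
  \<open>(w, -1)\<close>. The points \<open>p n\<close> belong to the epigraph, so they never exceed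
  it, and by \<open>inner_closest_point_ge\<close> their shortfall against any fixed point of the
  epigraph tends to 0.\<close>

lemma conjugate_eq_liminf:
  fixes h :: "real^'m \<Rightarrow> 'a \<Rightarrow> ereal" and w :: "real^'m"
  assumes E: "closed (ereal_epigraph (\<lambda>x. h x \<omega>))" "convex (ereal_epigraph (\<lambda>x. h x \<omega>))"
    and a: "\<bar>h a \<omega>\<bar> \<noteq> \<infinity>"
  defines "p \<equiv> \<lambda>n. closest_point (ereal_epigraph (\<lambda>x. h x \<omega>)) (real n *\<^sub>R (w, -1))"
  shows "conjugate h w \<omega> = liminf (\<lambda>n. ereal (fst (p n) \<bullet> w - snd (p n)))"
proof (rule antisym)
  let ?E = "ereal_epigraph (\<lambda>x. h x \<omega>)"
  have ne: "?E \<noteq> {}"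
    using a by (auto simp: ereal_epigraph_def intro!: exI[of _ a] exI[of _ "real_of_ereal (h a \<omega>)"])
  show "conjugate h w \<omega> \<le> liminf (\<lambda>n. ereal (fst (p n) \<bullet> w - snd (p n)))"
    unfolding conjugate_def
  proof (rule SUP_least)
    fix x
    show "ereal (x \<bullet> w) - h x \<omega> \<le> liminf (\<lambda>n. ereal (fst (p n) \<bullet> w - snd (p n)))"
    proof (cases "h x \<omega>")
      case (real r)
      define s where "s = (x, r)"
      have s: "s \<in> ?E" using real by (simp add: s_def ereal_epigraph_def)
      have "(\<lambda>n. (w, -1) \<bullet> s - (norm s)\<^sup>2 / 4 * inverse (real n)) \<longlonglongrightarrow> (w, -1) \<bullet> s - (norm s)\<^sup>2 / 4 * 0"
        by (intro tendsto_intros lim_inverse_n)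
      then have "(\<lambda>n. ereal ((w, -1) \<bullet> s - (norm s)\<^sup>2 / (4 * real n))) \<longlonglongrightarrow> ereal (x \<bullet> w - r)"
        by (simp add: s_def inverse_eq_divide inner_commute)
      then have "ereal (x \<bullet> w - r) = liminf (\<lambda>n. ereal ((w, -1) \<bullet> s - (norm s)\<^sup>2 / (4 * real n)))"
        by (intro lim_imp_Liminf[symmetric]) simp
      also have "\<dots> \<le> liminf (\<lambda>n. ereal (fst (p n) \<bullet> w - snd (p n)))"
      proof (rule Liminf_mono, rule eventually_mono[OF eventually_gt_at_top[of 0]])
        fix n :: nat assume "0 < n"
        then have "(w, -1) \<bullet> s - (norm s)\<^sup>2 / (4 * real n) \<le> (w, -1) \<bullet> p n"
          unfolding p_def by (intro inner_closest_point_ge E s) simp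
        also have "\<dots> = fst (p n) \<bullet> w - snd (p n)"
          by (cases "p n") (simp add: inner_commute)
        finally show "ereal ((w, -1) \<bullet> s - (norm s)\<^sup>2 / (4 * real n)) \<le> ereal (fst (p n) \<bullet> w - snd (p n))"
          by simp
      qed
      finally show ?thesis using real by simp
    qed (use closed_convex_epigraph_not_MInf[OF E a, of x] in auto)
  qed
  have "ereal (fst (p n) \<bullet> w - snd (p n)) \<le> conjugate h w \<omega>" for n
  proof -
    have "p n \<in> ?E" unfolding p_def using E(1) ne by (rule closest_point_in_set)
    then have "h (fst (p n)) \<omega> \<le> ereal (snd (p n))" by (auto simp: ereal_epigraph_def)
    then have "ereal (fst (p n) \<bullet> w) - ereal (snd (p n)) \<le> ereal (fst (p n) \<bullet> w) - h (fst (p n)) \<omega>"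
      by (intro ereal_minus_mono) auto
    also have "\<dots> \<le> conjugate h w \<omega>" by (rule conjugate_upper)
    finally show ?thesis by simp
  qed
  then show "liminf (\<lambda>n. ereal (fst (p n) \<bullet> w - snd (p n))) \<le> conjugate h w \<omega>"
    by (rule liminf_le_const)
qed

text \<open>Fenchel--Moreau with an explicit affine minorant: if \<open>(u, \<alpha>)\<close> lies strictly below the graph,
  the hyperplane through its projection \<open>p\<close> onto the epigraph either has a slope \<open>y\<close>, or is vertical, in
  which case a large multiple of its normal is added to a known element \<open>y0\<close> of \<open>dom h\<^sup>*\<close>.\<close>

definition separating_slope :: "real^'m \<Rightarrow> real \<Rightarrow> real^'m \<Rightarrow> real \<Rightarrow> (real^'m) \<times> real \<Rightarrow> real^'m" where
  "separating_slope u \<alpha> y0 g p =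
     (let n = u - fst p; c = snd p - \<alpha> in
       if 0 < c then n /\<^sub>R c else y0 + (max 0 (\<alpha> - u \<bullet> y0 + g) / (n \<bullet> n)) *\<^sub>R n)"

text \<open>A bound for the conjugate at \<open>separating_slope\<close>, so that slope and value
  together describe an affine minorant. In the nonvertical case this minorant passes through
  \<open>p\<close>.\<close>

definition separating_value :: "real^'m \<Rightarrow> real \<Rightarrow> real^'m \<Rightarrow> real \<Rightarrow> (real^'m) \<times> real \<Rightarrow> real" where
  "separating_value u \<alpha> y0 g p =
     (let n = u - fst p; c = snd p - \<alpha> in
       if 0 < c then (n \<bullet> fst p) / c - snd p
       else g + (max 0 (\<alpha> - u \<bullet> y0 + g) / (n \<bullet> n)) * (n \<bullet> fst p))"

lemma separating_slope_value:
  fixes h :: "real^'m \<Rightarrow> 'a \<Rightarrow> ereal"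
  assumes E: "closed (ereal_epigraph (\<lambda>x. h x \<omega>))" "convex (ereal_epigraph (\<lambda>x. h x \<omega>))"
    and a: "\<bar>h a \<omega>\<bar> \<noteq> \<infinity>"
    and \<alpha>: "ereal \<alpha> < h u \<omega>" and g: "conjugate h y0 \<omega> \<le> ereal g"
  defines "p \<equiv> closest_point (ereal_epigraph (\<lambda>x. h x \<omega>)) (u, \<alpha>)"
  shows "conjugate h (separating_slope u \<alpha> y0 g p) \<omega> \<le> ereal (separating_value u \<alpha> y0 g p)"
    and "\<alpha> \<le> separating_slope u \<alpha> y0 g p \<bullet> u - separating_value u \<alpha> y0 g p"
proof -
  let ?E = "ereal_epigraph (\<lambda>x. h x \<omega>)"
  have ne: "?E \<noteq> {}"
    using a by (auto simp: ereal_epigraph_def intro!: exI[of _ a] exI[of _ "real_of_ereal (h a \<omega>)"])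
  obtain x r where p: "p = (x, r)" by (cases p)
  have pE: "(x, r) \<in> ?E"
    unfolding p[symmetric] p_def using E(1) ne by (rule closest_point_in_set)
  define n where "n = u - x"
  define c where "c = r - \<alpha>"
  have sep: "n \<bullet> (x' - x) \<le> c * (r' - r)" if "(x', r') \<in> ?E" for x' r'
  proof -
    have "((u, \<alpha>) - p) \<bullet> ((x', r') - p) \<le> 0"
      unfolding p_def using E that by (intro closest_point_dot)
    then show ?thesis by (simp add: p n_def c_def algebra_simps)
  qed
  \<comment> \<open>Moving upwards stays in the epigraph, so the separation inequality forces the
    vertical component \<open>c\<close> of the normal to be nonnegative.\<close>
  have "(x, r + 1) \<in> ?E"
    using pE by (auto simp: ereal_epigraph_def intro: order_trans)
  from sep[OF this] have "c \<ge> 0" by simp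
  have conj_le: "conjugate h y \<omega> \<le> ereal b" if b: "\<And>x' r'. h x' \<omega> = ereal r' \<Longrightarrow> x' \<bullet> y - r' \<le> b" for y b
    unfolding conjugate_def
  proof (rule SUP_least)
    fix x'
    show "ereal (x' \<bullet> y) - h x' \<omega> \<le> ereal b"
      using b[of x'] closed_convex_epigraph_not_MInf[OF E a, of x'] by (cases "h x' \<omega>") auto
  qed
  show "conjugate h (separating_slope u \<alpha> y0 g p) \<omega> \<le> ereal (separating_value u \<alpha> y0 g p)"
  proof (rule conj_le)
    fix x' r' assume h: "h x' \<omega> = ereal r'"
    then have s: "n \<bullet> (x' - x) \<le> c * (r' - r)" by (intro sep) (simp add: ereal_epigraph_def)
    show "x' \<bullet> separating_slope u \<alpha> y0 g p - r' \<le> separating_value u \<alpha> y0 g p"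
    proof (cases "c > 0")
      case True
      then have "(n \<bullet> x') / c - (n \<bullet> x) / c \<le> r' - r"
        using s by (simp add: field_simps inner_diff_right)
      then show ?thesis
        using True by (simp add: separating_slope_def separating_value_def p Let_def
            n_def[symmetric] c_def[symmetric] inner_commute[of x'] divide_inverse mult.commute)
    next
      case False
      then have "n \<bullet> x' \<le> n \<bullet> x" using s \<open>c \<ge> 0\<close> by (simp add: inner_diff_right)
      then have "(max 0 (\<alpha> - u \<bullet> y0 + g) / (n \<bullet> n)) * (n \<bullet> x') \<le> (max 0 (\<alpha> - u \<bullet> y0 + g) / (n \<bullet> n)) * (n \<bullet> x)"
        by (intro mult_left_mono) auto
      moreover have "x' \<bullet> y0 - r' \<le> g"
        using order_trans[OF conjugate_upper g, of x'] h by simp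
      ultimately show ?thesis
        using False by (simp add: separating_slope_def separating_value_def p Let_def
            n_def[symmetric] c_def[symmetric] inner_commute[of x'] inner_add_left)
    qed
  qed
  show "\<alpha> \<le> separating_slope u \<alpha> y0 g p \<bullet> u - separating_value u \<alpha> y0 g p"
  proof (cases "c > 0")
    case True
    have "separating_slope u \<alpha> y0 g p \<bullet> u - separating_value u \<alpha> y0 g p = (n \<bullet> u - n \<bullet> x) / c + r"
      using True by (simp add: separating_slope_def separating_value_def p Let_def
          n_def[symmetric] c_def[symmetric] divide_inverse mult.commute right_diff_distrib)
    also have "n \<bullet> u - n \<bullet> x = n \<bullet> n" by (simp add: n_def algebra_simps)
    finally have "separating_slope u \<alpha> y0 g p \<bullet> u - separating_value u \<alpha> y0 g p = (n \<bullet> n) / c + r" .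
    moreover have "0 \<le> (n \<bullet> n) / c" using True by simp
    ultimately show ?thesis
      using True unfolding c_def by linarith
  next
    case False
    then have "r = \<alpha>" using \<open>c \<ge> 0\<close> by (simp add: c_def)
    \<comment> \<open>Otherwise the projection would be \<open>(u, \<alpha>)\<close> itself, which
      lies strictly below the graph.\<close>
    then have "n \<noteq> 0" using pE \<alpha> by (auto simp: n_def ereal_epigraph_def)
    \<comment> \<open>The least nonnegative multiple of \<open>n\<close> that lifts the known
      minorant from \<open>u \<bullet> y0 - g\<close> to at least \<open>\<alpha>\<close> at
      \<open>u\<close>; a unit of \<open>n\<close> lifts it there by
      \<open>n \<bullet> n\<close>.\<close>
    define t where "t = max 0 (\<alpha> - u \<bullet> y0 + g) / (n \<bullet> n)"
    have "separating_slope u \<alpha> y0 g p = y0 + t *\<^sub>R n" "separating_value u \<alpha> y0 g p = g + t * (n \<bullet> x)"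
      using False by (simp_all add: separating_slope_def separating_value_def p Let_def n_def c_def t_def)
    then have "separating_slope u \<alpha> y0 g p \<bullet> u - separating_value u \<alpha> y0 g p =
        u \<bullet> y0 + t * (n \<bullet> u) - (g + t * (n \<bullet> x))"
      by (simp add: inner_add_left inner_commute[of y0])
    also have "\<dots> = u \<bullet> y0 - g + t * (n \<bullet> n)"
      by (simp add: n_def algebra_simps)
    also have "t * (n \<bullet> n) = max 0 (\<alpha> - u \<bullet> y0 + g)"
      using \<open>n \<noteq> 0\<close> by (simp add: t_def)
    finally show ?thesis by simp
  qed
qed

section \<open>Conjugates and subdifferentials of integral functionals\<close>

locale integral_functional_pair = prob_space M
  for M :: "'a measure" and U Y :: "('a \<Rightarrow> real^'m) set" and h :: "real^'m \<Rightarrow> 'a \<Rightarrow> ereal" +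
  assumes U: "U \<subseteq> borel_measurable M" "linear_space U" "decomposable M U" "solid M U"
    and Y: "Y \<subseteq> borel_measurable M" "linear_space Y" "decomposable M Y"
    and UY: "\<And>u y. u \<in> U \<Longrightarrow> y \<in> Y \<Longrightarrow> integrable M (\<lambda>\<omega>. u \<omega> \<bullet> y \<omega>)"
    and h: "convex_normal_integrand M h"
    and proper: "proper_on U (integral_functional M h)"
begin

abbreviation "Eh \<equiv> integral_functional M h"
abbreviation "Ehc \<equiv> integral_functional M (conjugate h)"
abbreviation "domE \<equiv> effective_domain U Eh"

lemma epigraph_closed_convex:
  assumes "\<omega> \<in> space M"
  shows "closed (ereal_epigraph (\<lambda>x. h x \<omega>))" "convex (ereal_epigraph (\<lambda>x. h x \<omega>))"
  using assms h by (auto simp: convex_normal_integrand_def)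

lemma dom_nonempty: "domE \<noteq> {}"
  using proper by (auto simp: proper_on_def effective_domain_def)

lemma dom_subset: "domE \<subseteq> U"
  by (auto simp: effective_domain_def)

lemma Eh_eq_PInf: "u \<in> U \<Longrightarrow> u \<notin> domE \<Longrightarrow> Eh u = \<infinity>"
  by (simp add: effective_domain_def)

lemma dom_integrable:
  assumes "u \<in> domE"
  obtains g where "integrable M g" "AE \<omega> in M. h (u \<omega>) \<omega> = ereal (g \<omega>)" "Eh u = ereal (LINT \<omega>|M. g \<omega>)"
proof -
  have u: "u \<in> borel_measurable M" using assms dom_subset U by auto
  have fin: "\<bar>Eh u\<bar> \<noteq> \<infinity>"
    using assms proper by (auto simp: proper_on_def effective_domain_def)
  obtain g where g: "integrable M g" "AE \<omega> in M. h (u \<omega>) \<omega> = ereal (g \<omega>)"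
    by (rule ereal_integral_finite_imp_integrable[OF convex_normal_integrand_measurable_comp[OF h u] AE_I2[OF refl]
        fin[unfolded integral_functional_def]])
  show thesis
    using that[OF g] ereal_integral_eq_integral[OF g] by (simp add: integral_functional_def)
qed

lemma Eh_le_integral:
  assumes "u \<in> U" "integrable M g" "AE \<omega> in M. h (u \<omega>) \<omega> \<le> ereal (g \<omega>)"
  shows "u \<in> domE" "Eh u \<le> ereal (LINT \<omega>|M. g \<omega>)"
proof -
  have "Eh u \<le> ereal_integral M (\<lambda>\<omega>. ereal (g \<omega>))"
    unfolding integral_functional_def by (rule ereal_integral_mono) fact
  also have "\<dots> = ereal (LINT \<omega>|M. g \<omega>)"
    using assms by (intro ereal_integral_eq_integral) auto
  finally show "Eh u \<le> ereal (LINT \<omega>|M. g \<omega>)" .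
  then show "u \<in> domE" using assms(1) by (auto simp: effective_domain_def)
qed

text \<open>A finite value of \<open>h\<close> in almost every scenario is what excludes empty
  epigraphs and, through \<open>closed_convex_epigraph_not_MInf\<close>, the value minus
  infinity.\<close>

lemma AE_finite_somewhere:
  obtains u0 where "u0 \<in> domE" "AE \<omega> in M. \<bar>h (u0 \<omega>) \<omega>\<bar> \<noteq> \<infinity>"
proof -
  obtain u0 where u0: "u0 \<in> domE" using dom_nonempty by blast
  then obtain g where "AE \<omega> in M. h (u0 \<omega>) \<omega> = ereal (g \<omega>)" by (rule dom_integrable)
  then have "AE \<omega> in M. \<bar>h (u0 \<omega>) \<omega>\<bar> \<noteq> \<infinity>" by eventually_elim simp
  with u0 show thesis by (rule that)
qed

section \<open>Measurable selections from the epigraph\<close>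

definition epi :: "'a \<Rightarrow> ((real^'m) \<times> real) set" where
  "epi \<omega> = totalize (ereal_epigraph (\<lambda>x. h x \<omega>))"

lemma epi_eq:
  assumes "\<bar>h a \<omega>\<bar> \<noteq> \<infinity>"
  shows "epi \<omega> = ereal_epigraph (\<lambda>x. h x \<omega>)"
proof -
  obtain c where "h a \<omega> = ereal c" using assms by (cases "h a \<omega>") auto
  then have "(a, c) \<in> ereal_epigraph (\<lambda>x. h x \<omega>)" by (simp add: ereal_epigraph_def)
  then have "ereal_epigraph (\<lambda>x. h x \<omega>) \<noteq> {}" by blast
  then show ?thesis by (simp add: epi_def totalize_def)
qed

lemma closest_point_epi_measurable:
  assumes "z \<in> borel_measurable M"
  shows "(\<lambda>\<omega>. closest_point (epi \<omega>) (z \<omega>)) \<in> borel_measurable M"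
  unfolding epi_def
proof (rule borel_measurable_closest_point[OF _ _ assms])
  show "measurable_set_valued M (\<lambda>\<omega>. totalize (ereal_epigraph (\<lambda>x. h x \<omega>)))"
    using h by (intro measurable_set_valued_totalize) (simp add: convex_normal_integrand_def)
qed (use epigraph_closed_convex in \<open>auto simp: totalize_def\<close>)

text \<open>The projections of \<open>real n *\<^sub>R (w \<omega>, -1)\<close> onto the epigraph do
  double duty: they are the selections for the interchange on \<open>U\<close>, and their liminf is
  a measurable version of \<open>conjugate h\<close> along \<open>w\<close>.\<close>

lemma conjugate_selections:
  assumes w: "w \<in> borel_measurable M"
  obtains x r where "\<And>n::nat. x n \<in> borel_measurable M" "\<And>n. r n \<in> borel_measurable M"
    and "\<And>n. AE \<omega> in M. h (x n \<omega>) \<omega> \<le> ereal (r n \<omega>)"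
    and "AE \<omega> in M. conjugate h (w \<omega>) \<omega> = liminf (\<lambda>n. ereal (x n \<omega> \<bullet> w \<omega> - r n \<omega>))"
proof
  define p where "p n \<omega> = closest_point (epi \<omega>) (real n *\<^sub>R (w \<omega>, -1))" for n \<omega>
  have [measurable]: "p n \<in> borel_measurable M" for n
    unfolding p_def by (intro closest_point_epi_measurable borel_measurable_scaleR borel_measurable_const borel_measurable_Pair w)
  show "(\<lambda>\<omega>. fst (p n \<omega>)) \<in> borel_measurable M" "(\<lambda>\<omega>. snd (p n \<omega>)) \<in> borel_measurable M" for n
    by (auto intro!: borel_measurable_continuous_on[OF _ \<open>p n \<in> borel_measurable M\<close>] continuous_intros)
  obtain u0 where u0: "AE \<omega> in M. \<bar>h (u0 \<omega>) \<omega>\<bar> \<noteq> \<infinity>" by (rule AE_finite_somewhere)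
  show "AE \<omega> in M. h (fst (p n \<omega>)) \<omega> \<le> ereal (snd (p n \<omega>))" for n
    using u0 AE_space
  proof eventually_elim
    case (elim \<omega>)
    have "p n \<omega> \<in> epi \<omega>" unfolding p_def
      using epigraph_closed_convex[OF elim(2)]
      by (intro closest_point_in_set) (auto simp: epi_def totalize_def)
    then show ?case by (auto simp: epi_eq[OF elim(1)] ereal_epigraph_def)
  qed
  show "AE \<omega> in M. conjugate h (w \<omega>) \<omega> = liminf (\<lambda>n. ereal (fst (p n \<omega>) \<bullet> w \<omega> - snd (p n \<omega>)))"
    using u0 AE_space
  proof eventually_elim
    case (elim \<omega>)
    show ?case
      unfolding p_def epi_eq[OF elim(1)]
      using conjugate_eq_liminf[where h=h and \<omega>=\<omega>, OF epigraph_closed_convex[OF elim(2)] elim(1)] .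
  qed
qed

section \<open>Conjugate duality between \<open>U\<close> and \<open>Y\<close>\<close>

lemma Eh_conjugate_ge:
  assumes u: "u \<in> U" and y: "y \<in> Y"
  shows "ereal (pairing M u y) - Eh u \<le> Ehc y"
proof (cases "u \<in> domE")
  case True
  then obtain g where g: "integrable M g" "AE \<omega> in M. h (u \<omega>) \<omega> = ereal (g \<omega>)" "Eh u = ereal (LINT \<omega>|M. g \<omega>)"
    by (rule dom_integrable)
  have "ereal (pairing M u y) - Eh u = ereal_integral M (\<lambda>\<omega>. ereal (u \<omega> \<bullet> y \<omega> - g \<omega>))"
    using g UY[OF u y] ereal_integral_eq_integral[of M "\<lambda>\<omega>. u \<omega> \<bullet> y \<omega> - g \<omega>"]
    by (simp add: pairing_def)
  also have "\<dots> \<le> Ehc y"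
    unfolding integral_functional_def
  proof (rule ereal_integral_mono)
    show "AE \<omega> in M. ereal (u \<omega> \<bullet> y \<omega> - g \<omega>) \<le> conjugate h (y \<omega>) \<omega>"
      using g(2)
    proof eventually_elim
      case (elim \<omega>)
      then show ?case using conjugate_upper[of "u \<omega>" "y \<omega>" h \<omega>] by simp
    qed
  qed
  finally show ?thesis .
qed (simp add: Eh_eq_PInf u)

theorem conjugate_Eh:
  assumes y: "y \<in> Y"
  shows "(SUP u\<in>U. ereal (pairing M u y) - Eh u) = Ehc y"
proof (rule antisym)
  show "(SUP u\<in>U. ereal (pairing M u y) - Eh u) \<le> Ehc y"
    using Eh_conjugate_ge[OF _ y] by (rule SUP_least)
  obtain u0 where u0: "u0 \<in> domE" using dom_nonempty by blast
  then obtain g0 where g0: "integrable M g0" "AE \<omega> in M. h (u0 \<omega>) \<omega> = ereal (g0 \<omega>)"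
    by (rule dom_integrable)
  have ym: "y \<in> borel_measurable M" using y Y by auto
  obtain x r where xr: "\<And>n::nat. x n \<in> borel_measurable M" "\<And>n. r n \<in> borel_measurable M"
    "\<And>n. AE \<omega> in M. h (x n \<omega>) \<omega> \<le> ereal (r n \<omega>)"
    and lim: "AE \<omega> in M. conjugate h (y \<omega>) \<omega> = liminf (\<lambda>n. ereal (x n \<omega> \<bullet> y \<omega> - r n \<omega>))"
    by (rule conjugate_selections[OF ym]) (rule that)
  show "Ehc y \<le> (SUP u\<in>U. ereal (pairing M u y) - Eh u)"
    unfolding integral_functional_def[of M "conjugate h"]
  proof (rule ereal_integral_le_of_selections[where f=h and x=x and r=r, OF U(3,1) ym _ _ g0(1) _ xr])
    show "u0 \<in> U" using u0 dom_subset by auto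
    show "AE \<omega> in M. h (u0 \<omega>) \<omega> \<le> ereal (g0 \<omega>)" using g0(2) by eventually_elim simp
    show "AE \<omega> in M. conjugate h (y \<omega>) \<omega> \<le> liminf (\<lambda>n. ereal (x n \<omega> \<bullet> y \<omega> - r n \<omega>))"
      using lim by eventually_elim simp
  qed (auto intro: UY y SUP_upper)
qed

lemma Ehc_not_MInf: "y \<in> Y \<Longrightarrow> Ehc y \<noteq> -\<infinity>"
proof -
  assume y: "y \<in> Y"
  obtain u0 where u0: "u0 \<in> domE" using dom_nonempty by blast
  then obtain c where "Eh u0 = ereal c" by (rule dom_integrable)
  then show "Ehc y \<noteq> -\<infinity>"
    using Eh_conjugate_ge[of u0 y] u0 y dom_subset by auto
qed

lemma Ehc_integrable:
  assumes y: "y \<in> Y" and fin: "Ehc y < \<infinity>"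
  obtains g where "integrable M g" "AE \<omega> in M. conjugate h (y \<omega>) \<omega> = ereal (g \<omega>)"
proof -
  have ym: "y \<in> borel_measurable M" using y Y by auto
  obtain x r where [measurable]: "\<And>n::nat. x n \<in> borel_measurable M" "\<And>n. r n \<in> borel_measurable M"
    and lim: "AE \<omega> in M. conjugate h (y \<omega>) \<omega> = liminf (\<lambda>n. ereal (x n \<omega> \<bullet> y \<omega> - r n \<omega>))"
    by (rule conjugate_selections[OF ym]) (rule that)
  have m: "(\<lambda>\<omega>. liminf (\<lambda>n. ereal (x n \<omega> \<bullet> y \<omega> - r n \<omega>))) \<in> borel_measurable M"
    using ym by measurable
  have "\<bar>ereal_integral M (\<lambda>\<omega>. conjugate h (y \<omega>) \<omega>)\<bar> \<noteq> \<infinity>"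
    using fin Ehc_not_MInf[OF y] unfolding integral_functional_def by auto
  with m lim show thesis
    by (rule ereal_integral_finite_imp_integrable) (rule that)
qed

text \<open>The interchange with the roles of the spaces exchanged: test space \<open>Y\<close>,
  integrand \<open>conjugate h\<close>, linear weight \<open>u\<close>. The pairs
  \<open>(x n, r n)\<close> are affine minorants of \<open>h\<close> whose values at
  \<open>u\<close> approach \<open>h (u \<omega>) \<omega>\<close> from below in the liminf.\<close>

theorem biconjugate_Eh:
  assumes y0: "y0 \<in> Y" "Ehc y0 < \<infinity>" and u: "u \<in> U"
  shows "Eh u \<le> (SUP y\<in>Y. ereal (pairing M y u) - Ehc y)"
proof -
  obtain g0 where g0: "integrable M g0" "AE \<omega> in M. conjugate h (y0 \<omega>) \<omega> = ereal (g0 \<omega>)"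
    by (rule Ehc_integrable[OF y0])
  have um[measurable]: "u \<in> borel_measurable M" and ym[measurable]: "y0 \<in> borel_measurable M"
    using y0 u U Y by auto
  have hm[measurable]: "(\<lambda>\<omega>. h (u \<omega>) \<omega>) \<in> borel_measurable M"
    by (rule convex_normal_integrand_measurable_comp[OF h um])
  have [measurable]: "g0 \<in> borel_measurable M" using g0 by auto
  \<comment> \<open>Real levels converging to \<open>h (u \<omega>) \<omega>\<close> and strictly
    below it, because \<open>separating_slope_value\<close> separates only points strictly below the
    graph.\<close>
  define \<alpha> where "\<alpha> n \<omega> = (if h (u \<omega>) \<omega> = \<infinity> then real n else real_of_ereal (h (u \<omega>) \<omega>) - 1 / Suc n)"
    for n :: nat and \<omega>
  have [measurable]: "\<alpha> n \<in> borel_measurable M" for n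
    unfolding \<alpha>_def by measurable
  define p where "p n \<omega> = closest_point (epi \<omega>) (u \<omega>, \<alpha> n \<omega>)" for n \<omega>
  have p[measurable]: "p n \<in> borel_measurable M" for n
    unfolding p_def by (intro closest_point_epi_measurable) measurable
  have [measurable]: "(\<lambda>\<omega>. fst (p n \<omega>)) \<in> borel_measurable M" "(\<lambda>\<omega>. snd (p n \<omega>)) \<in> borel_measurable M" for n
    by (auto intro!: borel_measurable_continuous_on[OF _ p] continuous_intros)
  define x where "x n \<omega> = separating_slope (u \<omega>) (\<alpha> n \<omega>) (y0 \<omega>) (g0 \<omega>) (p n \<omega>)" for n \<omega>
  define r where "r n \<omega> = separating_value (u \<omega>) (\<alpha> n \<omega>) (y0 \<omega>) (g0 \<omega>) (p n \<omega>)" for n \<omega>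
  have x: "x n \<in> borel_measurable M" and r: "r n \<in> borel_measurable M" for n
    unfolding x_def r_def separating_slope_def separating_value_def Let_def by measurable
  obtain u0 where u0: "AE \<omega> in M. \<bar>h (u0 \<omega>) \<omega>\<bar> \<noteq> \<infinity>" by (rule AE_finite_somewhere)
  have sel: "AE \<omega> in M. conjugate h (x n \<omega>) \<omega> \<le> ereal (r n \<omega>) \<and> \<alpha> n \<omega> \<le> x n \<omega> \<bullet> u \<omega> - r n \<omega>" for n
    using u0 g0(2) AE_space
  proof eventually_elim
    case (elim \<omega>)
    note E = epigraph_closed_convex[OF elim(3)]
    have "h (u \<omega>) \<omega> \<noteq> -\<infinity>"
      by (rule closed_convex_epigraph_not_MInf[where f="\<lambda>x. h x \<omega>", OF E elim(1)])
    then have "ereal (\<alpha> n \<omega>) < h (u \<omega>) \<omega>"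
      by (cases "h (u \<omega>) \<omega>") (auto simp: \<alpha>_def)
    then show ?case
      using separating_slope_value[where h=h and \<omega>=\<omega>, OF E elim(1), of "\<alpha> n \<omega>" "u \<omega>" "y0 \<omega>" "g0 \<omega>"] elim(2)
      by (simp add: x_def r_def p_def epi_eq[OF elim(1)])
  qed
  show ?thesis
    unfolding integral_functional_def[of M h]
  proof (rule ereal_integral_le_of_selections[where f="conjugate h" and x=x and r=r, OF Y(3,1) um _ y0(1) g0(1) _ x r])
    show "AE \<omega> in M. conjugate h (y0 \<omega>) \<omega> \<le> ereal (g0 \<omega>)" using g0(2) by eventually_elim simp
    show "AE \<omega> in M. conjugate h (x n \<omega>) \<omega> \<le> ereal (r n \<omega>)" for n
      using sel[of n] by eventually_elim simp
    have "AE \<omega> in M. \<forall>n. \<alpha> n \<omega> \<le> x n \<omega> \<bullet> u \<omega> - r n \<omega>"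
      using sel by (subst AE_all_countable) (auto elim: eventually_mono)
    then show "AE \<omega> in M. h (u \<omega>) \<omega> \<le> liminf (\<lambda>n. ereal (x n \<omega> \<bullet> u \<omega> - r n \<omega>))"
      using u0 AE_space
    proof eventually_elim
      case (elim \<omega>)
      have "h (u \<omega>) \<omega> \<noteq> -\<infinity>"
        by (rule closed_convex_epigraph_not_MInf[where f="\<lambda>x. h x \<omega>", OF epigraph_closed_convex[OF elim(3)] elim(2)])
      have "(\<lambda>n. ereal (\<alpha> n \<omega>)) \<longlonglongrightarrow> h (u \<omega>) \<omega>"
      proof (cases "h (u \<omega>) \<omega>")
        case (real c)
        have "(\<lambda>n. c - inverse (real (Suc n))) \<longlonglongrightarrow> c - 0"
          by (intro tendsto_intros LIMSEQ_inverse_real_of_nat)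
        then show ?thesis using real by (simp add: \<alpha>_def inverse_eq_divide)
      next
        case PInf
        then show ?thesis
          using id_nat_ereal_tendsto_PInf by (simp add: \<alpha>_def)
      qed (use \<open>h (u \<omega>) \<omega> \<noteq> -\<infinity>\<close> in auto)
      then have "h (u \<omega>) \<omega> = liminf (\<lambda>n. ereal (\<alpha> n \<omega>))"
        by (intro lim_imp_Liminf[symmetric]) auto
      also have "\<dots> \<le> liminf (\<lambda>n. ereal (x n \<omega> \<bullet> u \<omega> - r n \<omega>))"
        using elim(1) by (intro Liminf_mono always_eventually) auto
      finally show ?case .
    qed
    show "integrable M (\<lambda>\<omega>. y \<omega> \<bullet> u \<omega>)" if "y \<in> Y" for y
      using UY[OF u that] by (simp add: inner_commute)
  qed (auto intro: SUP_upper)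
qed

section \<open>Singular functionals and the full dual\<close>

lemma pairing_diff:
  assumes "u \<in> U" "v \<in> U" "y \<in> Y"
  shows "pairing M (\<lambda>\<omega>. u \<omega> - v \<omega>) y = pairing M u y - pairing M v y"
  using UY[OF assms(1,3)] UY[OF assms(2,3)] by (simp add: pairing_def inner_diff_left)

text \<open>Replacing \<open>u1\<close> by \<open>u2\<close> on small sets \<open>A n\<close> changes nothing in the limit for \<open>Eh\<close> and for
  the elements of \<open>Y\<close>, whereas a singular functional only sees \<open>u2\<close>.\<close>

lemma singular_switch:
  assumes \<phi>: "\<phi> \<in> singular_dual M U T" and u1: "u1 \<in> domE" and u2: "u2 \<in> domE"
  obtains s :: "nat \<Rightarrow> 'a \<Rightarrow> real^'m" where "\<And>n. s n \<in> U" "\<And>n. \<phi> (s n) = \<phi> u2"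
    and "(\<lambda>n. Eh (s n)) \<longlonglongrightarrow> Eh u1"
    and "\<And>y. y \<in> Y \<Longrightarrow> (\<lambda>n. pairing M (s n) y) \<longlonglongrightarrow> pairing M u1 y"
proof -
  define w where "w = (\<lambda>\<omega>. u2 \<omega> - u1 \<omega>)"
  have uU: "u1 \<in> U" "u2 \<in> U" using u1 u2 dom_subset by auto
  then have wU: "w \<in> U" unfolding w_def using U(2) linear_space_diff by blast
  obtain A :: "nat \<Rightarrow> 'a set" where A: "range A \<subseteq> sets M" "decseq A" "(\<lambda>n. measure M (A n)) \<longlonglongrightarrow> 0"
    and A0: "\<And>n. \<phi> (\<lambda>\<omega>. indicat_real (space M - A n) \<omega> *\<^sub>R w \<omega>) = 0"
    using \<phi> wU unfolding singular_dual_def by blast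
  have [measurable]: "A n \<in> sets M" for n using A by auto
  have [measurable]: "w \<in> borel_measurable M" using wU U by auto
  have lin: "\<phi> (\<lambda>\<omega>. a *\<^sub>R u \<omega> + b *\<^sub>R v \<omega>) = a * \<phi> u + b * \<phi> v" if "u \<in> U" "v \<in> U" for u v a b
    using \<phi> that unfolding singular_dual_def dual_def by blast
  \<comment> \<open>The part of \<open>w\<close> outside \<open>A n\<close>, which
    \<open>\<phi>\<close> annihilates. On the rest \<open>d n\<close> the functional has the value
    \<open>\<phi> w\<close>, and on \<open>space M\<close> the sum \<open>s n\<close> of
    \<open>u1\<close> and \<open>d n\<close> is \<open>u2\<close> on \<open>A n\<close> and
    \<open>u1\<close> elsewhere. Solidity keeps \<open>c n\<close> in \<open>U\<close>.\<close>
  define c where "c n = (\<lambda>\<omega>. indicat_real (space M - A n) \<omega> *\<^sub>R w \<omega>)" for n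
  have cU: "c n \<in> U" for n
    unfolding c_def
    by (rule U(4)[unfolded solid_def, rule_format, OF wU]) (auto simp: indicator_def)
  define d where "d n = (\<lambda>\<omega>. 1 *\<^sub>R w \<omega> + (-1) *\<^sub>R c n \<omega>)" for n
  have dU: "d n \<in> U" for n
    unfolding d_def by (intro linear_space_combine U wU cU)
  define s where "s n = (\<lambda>\<omega>. 1 *\<^sub>R u1 \<omega> + 1 *\<^sub>R d n \<omega>)" for n
  have sU: "s n \<in> U" for n
    unfolding s_def by (intro linear_space_combine U uU dU)
  have s_eq: "s n \<omega> = u1 \<omega> + indicat_real (A n) \<omega> *\<^sub>R w \<omega>" if "\<omega> \<in> space M" for n \<omega>
    using that by (auto simp: s_def d_def c_def indicator_def)
  have "\<phi> w = \<phi> u2 - \<phi> u1"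
    using lin[OF uU(2,1), of 1 "-1"] by (simp add: w_def)
  then have \<phi>s: "\<phi> (s n) = \<phi> u2" for n
    using lin[OF uU(1) dU, of 1 1 n] lin[OF wU cU, of 1 "-1" n] A0[of n]
    by (simp add: s_def[symmetric] d_def[symmetric] c_def[symmetric])
      (simp add: s_def d_def c_def)
  obtain g1 where g1: "integrable M g1" "AE \<omega> in M. h (u1 \<omega>) \<omega> = ereal (g1 \<omega>)" "Eh u1 = ereal (LINT \<omega>|M. g1 \<omega>)"
    using u1 by (rule dom_integrable)
  obtain g2 where g2: "integrable M g2" "AE \<omega> in M. h (u2 \<omega>) \<omega> = ereal (g2 \<omega>)" "Eh u2 = ereal (LINT \<omega>|M. g2 \<omega>)"
    using u2 by (rule dom_integrable)
  have ind: "integrable M (\<lambda>\<omega>. indicat_real (A n) \<omega> * f \<omega>)" if "integrable M f" for f n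
    using integrable_mult_indicator[OF _ that, of "A n"] by simp
  have lim: "(\<lambda>n. LINT \<omega>|M. f1 \<omega> + indicat_real (A n) \<omega> * f \<omega>) \<longlonglongrightarrow> (LINT \<omega>|M. f1 \<omega>)"
    if "integrable M f1" "integrable M f" for f1 f
  proof -
    have "(\<lambda>n. (LINT \<omega>|M. f1 \<omega>) + (LINT \<omega>|M. indicat_real (A n) \<omega> * f \<omega>)) \<longlonglongrightarrow> (LINT \<omega>|M. f1 \<omega>) + 0"
      using A that by (intro tendsto_intros set_integral_decseq_tendsto_0) auto
    then show ?thesis using ind that by simp
  qed
  have Es: "Eh (s n) = ereal (LINT \<omega>|M. g1 \<omega> + indicat_real (A n) \<omega> * (g2 \<omega> - g1 \<omega>))" for n
    unfolding integral_functional_def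
  proof (rule ereal_integral_eq_integral)
    show "integrable M (\<lambda>\<omega>. g1 \<omega> + indicat_real (A n) \<omega> * (g2 \<omega> - g1 \<omega>))"
      using ind g1 g2 by simp
    show "AE \<omega> in M. h (s n \<omega>) \<omega> = ereal (g1 \<omega> + indicat_real (A n) \<omega> * (g2 \<omega> - g1 \<omega>))"
      using g1(2) g2(2) AE_space
      by eventually_elim (auto simp: s_eq w_def indicator_def)
  qed
  show thesis
  proof (rule that)
    show "(\<lambda>n. Eh (s n)) \<longlonglongrightarrow> Eh u1"
      unfolding Es g1(3) using lim g1 g2 by (intro tendsto_ereal) auto
    fix y assume y: "y \<in> Y"
    have "pairing M (s n) y = (LINT \<omega>|M. u1 \<omega> \<bullet> y \<omega> + indicat_real (A n) \<omega> * (w \<omega> \<bullet> y \<omega>))" for n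
      unfolding pairing_def by (intro Bochner_Integration.integral_cong refl) (simp add: s_eq inner_add_left)
    then show "(\<lambda>n. pairing M (s n) y) \<longlonglongrightarrow> pairing M u1 y"
      using lim[OF UY[OF uU(1) y] UY[OF wU y]] by (simp add: pairing_def)
  qed (use sU \<phi>s in auto)
qed

theorem conjugate_functional_Eh:
  assumes \<phi>: "\<phi> \<in> dual U T" and yc: "yc \<in> Y" and ys: "ys \<in> singular_dual M U T"
    and dec: "decomposes M U \<phi> yc ys"
  shows "conjugate_functional U Eh \<phi> = Ehc yc + support_functional domE ys"
proof (rule antisym)
  have \<phi>_eq: "\<phi> u = pairing M u yc + ys u" if "u \<in> U" for u
    using dec that by (simp add: decomposes_def)
  show "conjugate_functional U Eh \<phi> \<le> Ehc yc + support_functional domE ys"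
    unfolding conjugate_functional_def
  proof (rule SUP_least)
    fix u assume u: "u \<in> U"
    show "ereal (\<phi> u) - Eh u \<le> Ehc yc + support_functional domE ys"
    proof (cases "u \<in> domE")
      case True
      obtain c where "Eh u = ereal c" by (rule dom_integrable[OF True])
      then have "ereal (\<phi> u) - Eh u = (ereal (pairing M u yc) - Eh u) + ereal (ys u)"
        using \<phi>_eq[OF u] by simp
      also have "\<dots> \<le> Ehc yc + support_functional domE ys"
        unfolding support_functional_def
        using Eh_conjugate_ge[OF u yc] SUP_upper[OF True, of "\<lambda>u. ereal (ys u)"] by (rule add_mono)
      finally show ?thesis .
    qed (simp add: Eh_eq_PInf u)
  qed
  define R where "R = conjugate_functional U Eh \<phi>"
  \<comment> \<open>Along the switched sequence, \<open>ys\<close> keeps its value at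
    \<open>u2\<close> while everything else tends to its value at \<open>u1\<close>; so
    \<open>u1\<close> and \<open>u2\<close> can be varied independently.\<close>
  have key: "(ereal (pairing M u1 yc) - Eh u1) + ereal (ys u2) \<le> R" if u1: "u1 \<in> U" and u2: "u2 \<in> domE" for u1 u2
  proof (cases "u1 \<in> domE")
    case True
    obtain s where s: "\<And>n. s n \<in> U" "\<And>n. ys (s n) = ys u2" "(\<lambda>n. Eh (s n)) \<longlonglongrightarrow> Eh u1"
      and sY: "\<And>y. y \<in> Y \<Longrightarrow> (\<lambda>n. pairing M (s n) y) \<longlonglongrightarrow> pairing M u1 y"
      using singular_switch[OF ys True u2] by blast
    obtain c where c: "Eh u1 = ereal c" by (rule dom_integrable[OF True])
    have "(\<lambda>n. ereal (pairing M (s n) yc + ys u2) - Eh (s n)) \<longlonglongrightarrow> ereal (pairing M u1 yc + ys u2) - Eh u1"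
      using s(3) sY[OF yc] c by (intro tendsto_diff_ereal tendsto_ereal tendsto_intros) auto
    moreover have "ereal (pairing M (s n) yc + ys u2) - Eh (s n) \<le> R" for n
      unfolding R_def conjugate_functional_def
      using s(1)[of n] s(2)[of n] \<phi>_eq[OF s(1)[of n]] by (intro SUP_upper2[of "s n"]) auto
    ultimately have "ereal (pairing M u1 yc + ys u2) - Eh u1 \<le> R"
      by (intro LIMSEQ_le_const2) auto
    then show ?thesis using c by (simp add: diff_add_eq)
  qed (simp add: Eh_eq_PInf u1)
  have sup: "Ehc yc + ereal (ys u2) \<le> R" if u2: "u2 \<in> domE" for u2
  proof -
    have "(SUP u\<in>U. ereal (pairing M u yc) - Eh u) \<le> R - ereal (ys u2)"
      using key[OF _ u2] by (intro SUP_least) (simp add: ereal_le_minus)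
    then show ?thesis
      by (simp add: conjugate_Eh[OF yc] ereal_le_minus)
  qed
  show "Ehc yc + support_functional domE ys \<le> R"
  \<comment> \<open>Only a finite \<open>Ehc yc\<close> can be moved to the other side; if it is
    infinite, a single \<open>u2\<close> already makes \<open>R\<close> infinite.\<close>
  proof (cases "Ehc yc")
    case (real c)
    have "ereal (ys u) \<le> R - Ehc yc" if "u \<in> domE" for u
      using sup[OF that] real by (simp add: ereal_le_minus add.commute)
    then have "support_functional domE ys \<le> R - Ehc yc"
      unfolding support_functional_def by (rule SUP_least)
    then show ?thesis using real by (simp add: ereal_le_minus add.commute)
  next
    case PInf
    obtain u2 where "u2 \<in> domE" using dom_nonempty by blast
    from sup[OF this] PInf have "R = \<infinity>" by simp
    then show ?thesis by simp
  qed (use Ehc_not_MInf[OF yc] in simp)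
qed

theorem subdifferential_Eh_iff:
  assumes v: "v \<in> U" and \<phi>: "\<phi> \<in> dual U T" and yc: "yc \<in> Y" and ys: "ys \<in> singular_dual M U T"
    and dec: "decomposes M U \<phi> yc ys" and ycd: "functional_of M U yc \<in> dual U T"
  shows "\<phi> \<in> subdifferential U T Eh v \<longleftrightarrow>
    functional_of M U yc \<in> subdifferential U T Eh v \<and> ys \<in> normal_cone U T domE v"
proof -
  have ysd: "ys \<in> dual U T" using ys by (simp add: singular_dual_def)
  have diff: "\<psi> (\<lambda>\<omega>. u \<omega> - v \<omega>) = \<psi> u - \<psi> v" if "\<psi> \<in> dual U T" "u \<in> U" "v \<in> U" for \<psi> u v
  proof -
    have "\<psi> (\<lambda>\<omega>. 1 *\<^sub>R u \<omega> + (-1) *\<^sub>R v \<omega>) = 1 * \<psi> u + (-1) * \<psi> v"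
      using that unfolding dual_def by blast
    then show ?thesis by simp
  qed
  have \<phi>_diff: "\<phi> (\<lambda>\<omega>. u \<omega> - v \<omega>) = (pairing M u yc - pairing M v yc) + (ys u - ys v)" if "u \<in> U" for u
    using dec that v by (simp add: diff[OF \<phi>] decomposes_def)
  have yc_diff: "functional_of M U yc (\<lambda>\<omega>. u \<omega> - v \<omega>) = pairing M u yc - pairing M v yc" if "u \<in> U" for u
    unfolding diff[OF ycd that v] using that v by (simp add: functional_of_def)
  show ?thesis
  proof (cases "v \<in> domE")
    case False
    then show ?thesis using v Eh_eq_PInf by (simp add: subdifferential_def)
  next
    case True
    obtain c where c: "Eh v = ereal c" by (rule dom_integrable[OF True])
    show ?thesis
    proof
      assume "\<phi> \<in> subdifferential U T Eh v"
      then have sub: "Eh v + ereal ((pairing M u yc - pairing M v yc) + (ys u - ys v)) \<le> Eh u" if "u \<in> U" for u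
        using that \<phi>_diff[OF that] by (auto simp: subdifferential_def)
      have "ys u - ys v \<le> 0" if u: "u \<in> domE" for u
      proof -
        \<comment> \<open>The sequence tends to \<open>v\<close> for \<open>Eh\<close> and
          \<open>yc\<close>, whereas \<open>ys\<close> sees \<open>u\<close>: in the limit only the
          singular part of the subgradient inequality survives.\<close>
        obtain s where s: "\<And>n. s n \<in> U" "\<And>n. ys (s n) = ys u" "(\<lambda>n. Eh (s n)) \<longlonglongrightarrow> Eh v"
          and sY: "\<And>y. y \<in> Y \<Longrightarrow> (\<lambda>n. pairing M (s n) y) \<longlonglongrightarrow> pairing M v y"
          using singular_switch[OF ys True u] by blast
        have "(\<lambda>n. Eh v + ereal ((pairing M (s n) yc - pairing M v yc) + (ys u - ys v))) \<longlonglongrightarrow>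
            Eh v + ereal ((pairing M v yc - pairing M v yc) + (ys u - ys v))"
          using sY[OF yc] unfolding c plus_ereal.simps(1) by (intro tendsto_intros)
        then have "Eh v + ereal ((pairing M v yc - pairing M v yc) + (ys u - ys v)) \<le> Eh v"
          using s(3) sub[OF s(1)] s(2) by (intro LIMSEQ_le) auto
        then show ?thesis by (simp add: c)
      qed
      then have "ys \<in> normal_cone U T domE v"
        using True v dom_subset by (auto simp: normal_cone_def ysd diff[OF ysd])
      moreover have "Eh v + ereal (pairing M u yc - pairing M v yc) \<le> Eh u" if uU: "u \<in> U" for u
      proof (cases "u \<in> domE")
        case u: True
        \<comment> \<open>Opposite switch: \<open>ys\<close> sees \<open>v\<close>, so its
          contribution cancels and the inequality for \<open>yc\<close> remains.\<close>
        obtain s where s: "\<And>n. s n \<in> U" "\<And>n. ys (s n) = ys v" "(\<lambda>n. Eh (s n)) \<longlonglongrightarrow> Eh u"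
          and sY: "\<And>y. y \<in> Y \<Longrightarrow> (\<lambda>n. pairing M (s n) y) \<longlonglongrightarrow> pairing M u y"
          using singular_switch[OF ys u True] by blast
        have "(\<lambda>n. Eh v + ereal (pairing M (s n) yc - pairing M v yc)) \<longlonglongrightarrow>
            Eh v + ereal (pairing M u yc - pairing M v yc)"
          using sY[OF yc] unfolding c plus_ereal.simps(1) by (intro tendsto_intros)
        then show ?thesis
          using s(3) sub[OF s(1)] s(2) by (intro LIMSEQ_le) auto
      qed (simp add: Eh_eq_PInf uU)
      then have "functional_of M U yc \<in> subdifferential U T Eh v"
        using c yc_diff by (auto simp: subdifferential_def ycd)
      ultimately show "functional_of M U yc \<in> subdifferential U T Eh v \<and> ys \<in> normal_cone U T domE v"
        by simp
    next
      assume *: "functional_of M U yc \<in> subdifferential U T Eh v \<and> ys \<in> normal_cone U T domE v"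
      have "Eh v + ereal (\<phi> (\<lambda>\<omega>. u \<omega> - v \<omega>)) \<le> Eh u" if uU: "u \<in> U" for u
      proof (cases "u \<in> domE")
        case u: True
        have "ys u - ys v \<le> 0"
          using * True u uU v by (auto simp: normal_cone_def diff[OF ysd, symmetric])
        then have "Eh v + ereal (\<phi> (\<lambda>\<omega>. u \<omega> - v \<omega>)) \<le> Eh v + ereal (pairing M u yc - pairing M v yc)"
          by (simp add: \<phi>_diff[OF uU] c)
        also have "\<dots> \<le> Eh u"
          using * uU yc_diff[OF uU] by (auto simp: subdifferential_def)
        finally show ?thesis .
      qed (simp add: Eh_eq_PInf uU)
      then show "\<phi> \<in> subdifferential U T Eh v"
        using c by (simp add: subdifferential_def \<phi>)
    qed
  qed
qed

end

section \<open>Topologies generated by seminorms\<close>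

lemma seminorm_onD:
  assumes p: "seminorm_on U p" and U: "linear_space U" and u: "u \<in> U"
  shows seminorm_on_add: "v \<in> U \<Longrightarrow> p (\<lambda>\<omega>. u \<omega> + v \<omega>) \<le> p u + p v"
    and seminorm_on_scale: "p (\<lambda>\<omega>. a *\<^sub>R u \<omega>) = \<bar>a\<bar> * p u"
    and seminorm_on_minus: "p (\<lambda>\<omega>. - u \<omega>) = p u"
    and seminorm_on_nonneg: "0 \<le> p u"
    and seminorm_on_zero: "p (\<lambda>\<omega>. 0) = 0"
proof -
  have add: "p (\<lambda>\<omega>. u \<omega> + v \<omega>) \<le> p u + p v" if "v \<in> U" for v
    using p u that unfolding seminorm_on_def by blast
  have scale: "p (\<lambda>\<omega>. a *\<^sub>R u \<omega>) = \<bar>a\<bar> * p u" for a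
    using p u unfolding seminorm_on_def by blast
  show "v \<in> U \<Longrightarrow> p (\<lambda>\<omega>. u \<omega> + v \<omega>) \<le> p u + p v" by (rule add)
  show "p (\<lambda>\<omega>. a *\<^sub>R u \<omega>) = \<bar>a\<bar> * p u" by (rule scale)
  show minus: "p (\<lambda>\<omega>. - u \<omega>) = p u" using scale[of "-1"] by simp
  show zero: "p (\<lambda>\<omega>. 0) = 0" using scale[of 0] by simp
  show "0 \<le> p u"
    using add[OF linear_space_minus[OF U u u]] minus zero by simp
qed

lemma seminorm_on_triangle:
  assumes p: "seminorm_on U p" and U: "linear_space U" and "u \<in> U" "v \<in> U" "w \<in> U"
  shows "p (\<lambda>\<omega>. u \<omega> - w \<omega>) \<le> p (\<lambda>\<omega>. u \<omega> - v \<omega>) + p (\<lambda>\<omega>. v \<omega> - w \<omega>)"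
  using seminorm_on_add[OF p U linear_space_diff[OF U assms(3,4)] linear_space_diff[OF U assms(4,5)]]
  by simp

lemma seminorm_on_sum:
  assumes "linear_space U" "\<And>p. p \<in> K \<Longrightarrow> seminorm_on U p"
  shows "seminorm_on U (\<lambda>u. \<Sum>p\<in>K. p u)"
  using assms unfolding seminorm_on_def
  by (auto simp: sum.distrib[symmetric] sum_distrib_left intro!: sum_mono sum.cong)

lemma seminorm_on_cmult:
  assumes q: "seminorm_on U q" and c: "0 \<le> (c::real)"
  shows "seminorm_on U (\<lambda>u. c * q u)"
  unfolding seminorm_on_def
proof (intro conjI ballI allI)
  fix u v assume "u \<in> U" "v \<in> U"
  then have "c * q (\<lambda>\<omega>. u \<omega> + v \<omega>) \<le> c * (q u + q v)"
    using q c unfolding seminorm_on_def by (intro mult_left_mono) blast+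
  then show "c * q (\<lambda>\<omega>. u \<omega> + v \<omega>) \<le> c * q u + c * q v"
    by (simp only: distrib_left)
next
  fix u a assume "u \<in> U"
  then have "q (\<lambda>\<omega>. a *\<^sub>R u \<omega>) = \<bar>a\<bar> * q u"
    using q unfolding seminorm_on_def by blast
  then show "c * q (\<lambda>\<omega>. a *\<^sub>R u \<omega>) = \<bar>a\<bar> * (c * q u)" by simp
qed

lemma topspace_seminorm_topology:
  assumes U: "linear_space U" and P: "\<And>p. p \<in> P \<Longrightarrow> seminorm_on U p" "P \<noteq> {}"
  shows "topspace (seminorm_topology U P) = U"
proof -
  have "u \<in> \<Union>{{v \<in> U. p (\<lambda>\<omega>. v \<omega> - u \<omega>) < e} | p u e. p \<in> P \<and> u \<in> U \<and> 0 < e}" if u: "u \<in> U" for u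
  proof -
    obtain p where p: "p \<in> P" using P by blast
    have "u \<in> {v \<in> U. p (\<lambda>\<omega>. v \<omega> - u \<omega>) < 1}"
      using seminorm_on_zero[OF P(1)[OF p] U u] u by simp
    then show ?thesis
      using p u zero_less_one by blast
  qed
  then show ?thesis
    unfolding seminorm_topology_def topology_generated_by_topspace by blast
qed

text \<open>By induction on the generation of \<open>W\<close>: the triangle inequality recentres a
  ball around \<open>w\<close> at \<open>u\<close>, and sums of seminorms over finite unions handle
  intersections.\<close>

lemma seminorm_topology_nhd:
  assumes U: "linear_space U" and P: "\<And>p. p \<in> P \<Longrightarrow> seminorm_on U p"
    and W: "openin (seminorm_topology U P) W" and u: "u \<in> W"
  obtains K e where "finite K" "K \<subseteq> P" "0 < e"
    and "\<And>v. v \<in> U \<Longrightarrow> (\<Sum>p\<in>K. p (\<lambda>\<omega>. v \<omega> - u \<omega>)) < e \<Longrightarrow> v \<in> W"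
proof -
  have gen: "generate_topology_on
      {{v \<in> U. p (\<lambda>\<omega>. v \<omega> - u \<omega>) < e} | p u e. p \<in> P \<and> u \<in> U \<and> 0 < e} W" (is "generate_topology_on ?S W")
    using W unfolding seminorm_topology_def openin_topology_generated_by_iff .
  have WU: "W \<subseteq> U"
    using openin_subset[OF W] unfolding seminorm_topology_def topology_generated_by_topspace by blast
  have "\<exists>K e. finite K \<and> K \<subseteq> P \<and> 0 < e \<and>
      (\<forall>v\<in>U. (\<Sum>p\<in>K. p (\<lambda>\<omega>. v \<omega> - u \<omega>)) < e \<longrightarrow> v \<in> W)" if "u \<in> U"
    using gen u
  proof induction
    case Empty
    then show ?case by simp
  next
    case (Int A B)
    obtain K1 e1 where 1: "finite K1" "K1 \<subseteq> P" "0 < e1"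
        "\<And>v. v \<in> U \<Longrightarrow> (\<Sum>p\<in>K1. p (\<lambda>\<omega>. v \<omega> - u \<omega>)) < e1 \<Longrightarrow> v \<in> A"
      using Int by blast
    obtain K2 e2 where 2: "finite K2" "K2 \<subseteq> P" "0 < e2"
        "\<And>v. v \<in> U \<Longrightarrow> (\<Sum>p\<in>K2. p (\<lambda>\<omega>. v \<omega> - u \<omega>)) < e2 \<Longrightarrow> v \<in> B"
      using Int by blast
    have "v \<in> A \<inter> B" if v: "v \<in> U" and s: "(\<Sum>p\<in>K1 \<union> K2. p (\<lambda>\<omega>. v \<omega> - u \<omega>)) < min e1 e2" for v
    proof -
      have nonneg: "0 \<le> p (\<lambda>\<omega>. v \<omega> - u \<omega>)" if "p \<in> K1 \<union> K2" for p
      proof -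
        have "p \<in> P" using that 1(2) 2(2) by blast
        then show ?thesis
          by (rule seminorm_on_nonneg[OF P U linear_space_diff[OF U v \<open>u \<in> U\<close>]])
      qed
      have "(\<Sum>p\<in>K1. p (\<lambda>\<omega>. v \<omega> - u \<omega>)) \<le> (\<Sum>p\<in>K1 \<union> K2. p (\<lambda>\<omega>. v \<omega> - u \<omega>))"
        using 1(1) 2(1) nonneg by (intro sum_mono2) auto
      moreover have "(\<Sum>p\<in>K2. p (\<lambda>\<omega>. v \<omega> - u \<omega>)) \<le> (\<Sum>p\<in>K1 \<union> K2. p (\<lambda>\<omega>. v \<omega> - u \<omega>))"
        using 1(1) 2(1) nonneg by (intro sum_mono2) auto
      ultimately show ?thesis
        using s 1(4)[OF v] 2(4)[OF v] by simp
    qed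
    moreover have "finite (K1 \<union> K2)" "K1 \<union> K2 \<subseteq> P" "0 < min e1 e2"
      using 1(1-3) 2(1-3) by auto
    ultimately show ?case by blast
  next
    case (UN \<A>)
    then obtain A where A: "A \<in> \<A>" "u \<in> A" by blast
    show ?case using UN.IH[OF A] A(1) by blast
  next
    case (Basis B)
    then obtain p w d where B: "B = {v \<in> U. p (\<lambda>\<omega>. v \<omega> - w \<omega>) < d}" "p \<in> P" "w \<in> U" by blast
    have "v \<in> B" if "v \<in> U" "p (\<lambda>\<omega>. v \<omega> - u \<omega>) < d - p (\<lambda>\<omega>. u \<omega> - w \<omega>)" for v
      using seminorm_on_triangle[OF P[OF B(2)] U that(1) \<open>u \<in> U\<close> B(3)] that by (simp add: B(1))
    then show ?case
      using B Basis.prems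
      by (intro exI[of _ "{p}"] exI[of _ "d - p (\<lambda>\<omega>. u \<omega> - w \<omega>)"]) auto
  qed
  then show thesis using that u WU by blast
qed

lemma openin_seminorm_topologyI:
  assumes U: "linear_space U" and P: "\<And>p. p \<in> P \<Longrightarrow> seminorm_on U p" "P \<noteq> {}" and WU: "W \<subseteq> U"
    and nhd: "\<And>u. u \<in> W \<Longrightarrow> \<exists>K e. finite K \<and> K \<subseteq> P \<and> 0 < e \<and>
      (\<forall>v\<in>U. (\<Sum>p\<in>K. p (\<lambda>\<omega>. v \<omega> - u \<omega>)) < e \<longrightarrow> v \<in> W)"
  shows "openin (seminorm_topology U P) W"
proof (subst openin_subopen, intro ballI)
  fix u assume u: "u \<in> W"
  then obtain K e where K: "finite K" "K \<subseteq> P" "0 < e"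
      "\<And>v. v \<in> U \<Longrightarrow> (\<Sum>p\<in>K. p (\<lambda>\<omega>. v \<omega> - u \<omega>)) < e \<Longrightarrow> v \<in> W"
    using nhd by metis
  \<comment> \<open>At most \<open>card K\<close> summands below \<open>d\<close> add up to strictly
    less than \<open>e\<close>; the added 1 also covers an empty \<open>K\<close>.\<close>
  define d where "d = e / (real (card K) + 1)"
  have d: "0 < d" using K by (simp add: d_def)
  define B where "B p = {v \<in> U. p (\<lambda>\<omega>. v \<omega> - u \<omega>) < d}" for p
  have uU: "u \<in> U" using u WU by blast
  have "openin (seminorm_topology U P) (B p)" if "p \<in> K" for p
    unfolding seminorm_topology_def B_def
    by (rule topology_generated_by_Basis) (use that K uU d in blast)
  then have "openin (seminorm_topology U P) (U \<inter> (\<Inter>p\<in>K. B p))"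
  proof (cases "K = {}")
    case True
    then show ?thesis
      using openin_topspace[of "seminorm_topology U P"] topspace_seminorm_topology[OF U P] by simp
  next
    case False
    have "openin (seminorm_topology U P) (\<Inter>p\<in>K. B p)"
      using False K(1) \<open>\<And>p. p \<in> K \<Longrightarrow> openin (seminorm_topology U P) (B p)\<close> by (intro openin_INT2) auto
    moreover have "U \<inter> (\<Inter>p\<in>K. B p) = (\<Inter>p\<in>K. B p)" using False by (auto simp: B_def)
    ultimately show ?thesis by simp
  qed
  moreover have "u \<in> U \<inter> (\<Inter>p\<in>K. B p)"
  proof -
    have "p (\<lambda>\<omega>. u \<omega> - u \<omega>) = 0" if "p \<in> K" for p
      using seminorm_on_zero[OF P(1) U uU, of p] that K(2) by auto
    then have "\<forall>p\<in>K. p (\<lambda>\<omega>. u \<omega> - u \<omega>) < d" using d by (metis (no_types, lifting))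
    then show ?thesis using uU by (simp add: B_def)
  qed
  moreover have "U \<inter> (\<Inter>p\<in>K. B p) \<subseteq> W"
  proof
    fix v assume v: "v \<in> U \<inter> (\<Inter>p\<in>K. B p)"
    then have "(\<Sum>p\<in>K. p (\<lambda>\<omega>. v \<omega> - u \<omega>)) \<le> (\<Sum>p\<in>K. d)"
      by (intro sum_mono) (force simp: B_def)
    also have "\<dots> < e" using K(3) by (simp add: d_def field_simps)
    finally show "v \<in> W" using K(4) v by blast
  qed
  ultimately show "\<exists>T. openin (seminorm_topology U P) T \<and> u \<in> T \<and> T \<subseteq> W" by blast
qed

text \<open>The linear functional is obtained below the inf-convolution of \<open>Q\<close> with the positively homogeneous
  hull of \<open>F\<close>.\<close>

lemma linear_minorant_of_convex:
  fixes U :: "('a \<Rightarrow> 'v::real_vector) set"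
  assumes U: "linear_space U" and Q: "seminorm_on U Q"
    and D: "D \<subseteq> U" "D \<noteq> {}"
    and cD: "\<And>u v s. u \<in> D \<Longrightarrow> v \<in> D \<Longrightarrow> 0 \<le> s \<Longrightarrow> s \<le> 1 \<Longrightarrow> (\<lambda>\<omega>. (1 - s) *\<^sub>R u \<omega> + s *\<^sub>R v \<omega>) \<in> D"
    and cF: "\<And>u v s. u \<in> D \<Longrightarrow> v \<in> D \<Longrightarrow> 0 \<le> s \<Longrightarrow> s \<le> 1 \<Longrightarrow>
      F (\<lambda>\<omega>. (1 - s) *\<^sub>R u \<omega> + s *\<^sub>R v \<omega>) \<le> (1 - s) * F u + s * F v"
    and FQ: "\<And>v. v \<in> D \<Longrightarrow> - Q v \<le> F v"
  obtains l where "\<And>u v a b. u \<in> U \<Longrightarrow> v \<in> U \<Longrightarrow> l (\<lambda>\<omega>. a *\<^sub>R u \<omega> + b *\<^sub>R v \<omega>) = a * l u + b * l v"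
    and "\<And>u. u \<in> U \<Longrightarrow> l u \<le> Q u" and "\<And>v. v \<in> D \<Longrightarrow> l v \<le> F v"
proof -
  define G where "G = (\<lambda>(t, v) w. Q (\<lambda>\<omega>. w \<omega> - t *\<^sub>R v \<omega>) + t * F v)"
  define I where "I = ({0..} :: real set) \<times> D"
  define p where "p w = (INF i\<in>I. G i w)" for w
  have wv: "(\<lambda>\<omega>. w \<omega> - t *\<^sub>R v \<omega>) \<in> U" if "w \<in> U" "v \<in> D" for w t v
    using that D by (intro linear_space_diff[OF U] linear_space_scale[OF U]) auto
  \<comment> \<open>The assumption \<open>FQ\<close> enters here: it makes the infimum finite and
    independent bounds uniform in the index.\<close>
  have below: "- Q w \<le> G i w" if w: "w \<in> U" and "i \<in> I" for w i
  proof -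
    obtain t v where i: "i = (t, v)" "0 \<le> t" "v \<in> D" using \<open>i \<in> I\<close> by (auto simp: I_def)
    have vU: "v \<in> U" using i D by auto
    have tv: "(\<lambda>\<omega>. t *\<^sub>R v \<omega>) \<in> U" using vU by (intro linear_space_scale[OF U])
    have "Q (\<lambda>\<omega>. (t *\<^sub>R v \<omega> - w \<omega>) + w \<omega>) \<le> Q (\<lambda>\<omega>. t *\<^sub>R v \<omega> - w \<omega>) + Q w"
      by (intro seminorm_on_add[OF Q U] linear_space_diff[OF U] tv w)
    moreover have "Q (\<lambda>\<omega>. - (w \<omega> - t *\<^sub>R v \<omega>)) = Q (\<lambda>\<omega>. w \<omega> - t *\<^sub>R v \<omega>)"
      using wv[OF w i(3)] by (intro seminorm_on_minus[OF Q U])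
    moreover have "Q (\<lambda>\<omega>. t *\<^sub>R v \<omega>) = t * Q v"
      using seminorm_on_scale[OF Q U vU, of t] i by simp
    moreover have "t * - Q v \<le> t * F v"
      using FQ i by (intro mult_left_mono) auto
    ultimately show ?thesis by (simp add: G_def i(1))
  qed
  have bdd: "bdd_below ((\<lambda>i. G i w) ` I)" if "w \<in> U" for w
    using below[OF that] by (intro bdd_belowI2)
  have "sublinear_on U p"
  proof (rule sublinear_on_INF[OF U, where I = I and Q = G])
    show "I \<noteq> {}" using D by (auto simp: I_def)
  next
    fix w1 w2 i j assume w: "w1 \<in> U" "w2 \<in> U" and ij: "i \<in> I" "j \<in> I"
    obtain t1 v1 t2 v2 where i: "i = (t1, v1)" "0 \<le> t1" "v1 \<in> D" and j: "j = (t2, v2)" "0 \<le> t2" "v2 \<in> D"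
      using ij by (auto simp: I_def)
    have Qadd: "Q (\<lambda>\<omega>. (w1 \<omega> - t1 *\<^sub>R v1 \<omega>) + (w2 \<omega> - t2 *\<^sub>R v2 \<omega>)) \<le>
        Q (\<lambda>\<omega>. w1 \<omega> - t1 *\<^sub>R v1 \<omega>) + Q (\<lambda>\<omega>. w2 \<omega> - t2 *\<^sub>R v2 \<omega>)"
      using w i j by (intro seminorm_on_add[OF Q U] wv)
    show "\<exists>k\<in>I. G k (\<lambda>\<omega>. w1 \<omega> + w2 \<omega>) \<le> G i w1 + G j w2"
    \<comment> \<open>For a positive total \<open>t\<close>, the sum of \<open>t1\<close> times
      \<open>v1\<close> and \<open>t2\<close> times \<open>v2\<close> is \<open>t\<close> times a
      point of \<open>D\<close>, with convex weight \<open>t2 / t\<close>. If both coefficients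
      vanish, \<open>F\<close> does not contribute and any element of \<open>D\<close> will
      do.\<close>
    proof (cases "t1 + t2 = 0")
      case True
      then have "t1 = 0" "t2 = 0" using i j by auto
      then show ?thesis
        using Qadd i j by (intro bexI[of _ "(0, v1)"]) (auto simp: G_def I_def)
    next
      case False
      define t where "t = t1 + t2"
      have t: "t > 0" using False i j by (simp add: t_def)
      define s where "s = t2 / t"
      have s: "0 \<le> s" "s \<le> 1" "t * s = t2" "t * (1 - s) = t1"
        using t i j by (auto simp: s_def t_def field_simps)
      define v where "v = (\<lambda>\<omega>. (1 - s) *\<^sub>R v1 \<omega> + s *\<^sub>R v2 \<omega>)"
      have "v \<in> D" unfolding v_def using i j s by (intro cD)
      have "t * F v \<le> t * ((1 - s) * F v1 + s * F v2)"
        unfolding v_def using t i j s by (intro mult_left_mono cF) auto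
      also have "\<dots> = (t * (1 - s)) * F v1 + (t * s) * F v2"
        by (simp only: distrib_left mult.assoc)
      finally have tF: "t * F v \<le> t1 * F v1 + t2 * F v2"
        by (simp only: s)
      have "t *\<^sub>R v \<omega> = t1 *\<^sub>R v1 \<omega> + t2 *\<^sub>R v2 \<omega>" for \<omega>
        unfolding v_def by (simp only: scaleR_add_right scaleR_scaleR s)
      then have "(\<lambda>\<omega>. (w1 \<omega> + w2 \<omega>) - t *\<^sub>R v \<omega>) =
          (\<lambda>\<omega>. (w1 \<omega> - t1 *\<^sub>R v1 \<omega>) + (w2 \<omega> - t2 *\<^sub>R v2 \<omega>))"
        by (simp add: algebra_simps)
      then have "G (t, v) (\<lambda>\<omega>. w1 \<omega> + w2 \<omega>) \<le> G i w1 + G j w2"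
        using Qadd tF by (simp add: G_def i(1) j(1))
      then show ?thesis
        using \<open>v \<in> D\<close> t by (intro bexI[of _ "(t, v)"]) (auto simp: I_def)
    qed
  next
    fix w i and s :: real assume w: "w \<in> U" and "i \<in> I" and s: "0 < s"
    then obtain t v where i: "i = (t, v)" "0 \<le> t" "v \<in> D" by (auto simp: I_def)
    have "Q (\<lambda>\<omega>. s *\<^sub>R (w \<omega> - t *\<^sub>R v \<omega>)) = s * Q (\<lambda>\<omega>. w \<omega> - t *\<^sub>R v \<omega>)"
      using seminorm_on_scale[OF Q U wv[OF w i(3)], of s] s by simp
    then have "G (s * t, v) (\<lambda>\<omega>. s *\<^sub>R w \<omega>) \<le> s * G i w"
      by (simp add: G_def i(1) algebra_simps)
    then show "\<exists>k\<in>I. G k (\<lambda>\<omega>. s *\<^sub>R w \<omega>) \<le> s * G i w"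
      using i s by (intro bexI[of _ "(s * t, v)"]) (auto simp: I_def)
  qed (use bdd in \<open>auto simp: p_def\<close>)
  then obtain l where l: "\<And>u v a b. u \<in> U \<Longrightarrow> v \<in> U \<Longrightarrow> l (\<lambda>\<omega>. a *\<^sub>R u \<omega> + b *\<^sub>R v \<omega>) = a * l u + b * l v"
    "\<And>u. u \<in> U \<Longrightarrow> l u \<le> p u"
    using Hahn_Banach_sublinear[OF U] by metis
  have pG: "p w \<le> G i w" if "w \<in> U" "i \<in> I" for w i
    unfolding p_def using that bdd by (intro cINF_lower)
  \<comment> \<open>The index \<open>(0, v)\<close> leaves \<open>Q u\<close>, and the index
    \<open>(1, v)\<close> at the point \<open>v\<close> leaves \<open>F v\<close>.\<close>
  show thesis
  proof (rule that)
    fix u assume u: "u \<in> U"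
    obtain v where "v \<in> D" using D by blast
    then show "l u \<le> Q u"
      using l(2)[OF u] pG[OF u, of "(0, v)"] by (simp add: G_def I_def)
  next
    fix v assume v: "v \<in> D"
    then have "v \<in> U" using D by auto
    then show "l v \<le> F v"
      using l(2)[of v] pG[of v "(1, v)"] v seminorm_on_zero[OF Q U, of v] by (simp add: G_def I_def)
  qed (rule l(1))
qed

section \<open>Lower semicontinuity\<close>

context integral_functional_pair
begin

lemma pairing_add_scale:
  assumes "u \<in> U" "v \<in> U" "y \<in> Y"
  shows "pairing M (\<lambda>\<omega>. u \<omega> + v \<omega>) y = pairing M u y + pairing M v y"
    and "pairing M (\<lambda>\<omega>. a *\<^sub>R u \<omega>) y = a * pairing M u y"
  using UY[OF assms(1,3)] UY[OF assms(2,3)] by (simp_all add: pairing_def inner_add_left)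

lemma seminorm_on_abs_pairing: "p \<in> (\<lambda>y u. \<bar>pairing M u y\<bar>) ` Y \<Longrightarrow> seminorm_on U p"
  by (auto simp: seminorm_on_def pairing_add_scale abs_mult abs_triangle_ineq)

lemma abs_pairing_nonempty: "(\<lambda>y u. \<bar>pairing M u y\<bar>) ` Y \<noteq> {}"
  using Y(2) by (auto simp: linear_space_def)

lemma topspace_weak_topology: "topspace (weak_topology M U Y) = U"
  unfolding weak_topology_def
  by (rule topspace_seminorm_topology[OF U(2) seminorm_on_abs_pairing abs_pairing_nonempty])

text \<open>If \<open>Eh u\<close> exceeds \<open>a\<close>, then by \<open>biconjugate_Eh\<close> a
  single \<open>y\<close> provides an affine minorant exceeding \<open>a\<close> at
  \<open>u\<close>. With margin \<open>e\<close> it still does so wherever the pairing of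
  \<open>v - u\<close> with \<open>y\<close> is below \<open>e\<close> in absolute value.\<close>

lemma weak_lsc_Eh:
  assumes y0: "y0 \<in> Y" "Ehc y0 < \<infinity>"
  shows "lsc_wrt (weak_topology M U Y) Eh"
  unfolding lsc_wrt_def topspace_weak_topology
proof
  fix a
  show "openin (weak_topology M U Y) {u \<in> U. a < Eh u}"
    unfolding weak_topology_def
  proof (rule openin_seminorm_topologyI[OF U(2) seminorm_on_abs_pairing abs_pairing_nonempty])
    fix u assume "u \<in> {u \<in> U. a < Eh u}"
    then have u: "u \<in> U" and a: "a < (SUP y\<in>Y. ereal (pairing M y u) - Ehc y)"
      using biconjugate_Eh[OF y0, of u] by auto
    from a[unfolded less_SUP_iff] obtain y where y: "y \<in> Y" "a < ereal (pairing M y u) - Ehc y"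
      by blast
    have comm: "pairing M y u = pairing M u y" by (simp add: pairing_def inner_commute)
    obtain c where c: "Ehc y = ereal c"
      using y Ehc_not_MInf[OF y(1)] by (cases "Ehc y") auto
    obtain z where z: "a < ereal z" "z < pairing M u y - c"
      using ereal_dense2[OF y(2)] by (auto simp: c comm)
    define e where "e = pairing M u y - c - z"
    have "a < Eh v" if v: "v \<in> U" and small: "\<bar>pairing M (\<lambda>\<omega>. v \<omega> - u \<omega>) y\<bar> < e" for v
    proof -
      have "z < pairing M v y - c"
        using small by (simp add: pairing_diff[OF v u y(1)] e_def abs_less_iff)
      moreover have "ereal (pairing M v y - c) \<le> Eh v"
        using Eh_conjugate_ge[OF v y(1)] by (cases "Eh v") (auto simp: c)
      ultimately have "ereal z < Eh v"
        by (metis ereal_less(2) less_le_trans less_ereal.simps(1))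
      then show ?thesis using z(1) by (rule less_trans[rotated])
    qed
    then show "\<exists>K e. finite K \<and> K \<subseteq> (\<lambda>y u. \<bar>pairing M u y\<bar>) ` Y \<and> 0 < e \<and>
        (\<forall>v\<in>U. (\<Sum>p\<in>K. p (\<lambda>\<omega>. v \<omega> - u \<omega>)) < e \<longrightarrow> v \<in> {u \<in> U. a < Eh u})"
      using y(1) z(2)
      by (intro exI[of _ "{\<lambda>u. \<bar>pairing M u y\<bar>}"] exI[of _ e]) (auto simp: e_def)
  qed auto
qed

lemma convex_combination_Eh:
  assumes u: "u \<in> domE" and v: "v \<in> domE" and s: "0 \<le> s" "s \<le> 1"
  shows "(\<lambda>\<omega>. (1 - s) *\<^sub>R u \<omega> + s *\<^sub>R v \<omega>) \<in> domE"
    and "Eh (\<lambda>\<omega>. (1 - s) *\<^sub>R u \<omega> + s *\<^sub>R v \<omega>) \<le>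
      ereal ((1 - s) * real_of_ereal (Eh u) + s * real_of_ereal (Eh v))"
proof -
  obtain g1 where g1: "integrable M g1" "AE \<omega> in M. h (u \<omega>) \<omega> = ereal (g1 \<omega>)" "Eh u = ereal (LINT \<omega>|M. g1 \<omega>)"
    using u by (rule dom_integrable)
  obtain g2 where g2: "integrable M g2" "AE \<omega> in M. h (v \<omega>) \<omega> = ereal (g2 \<omega>)" "Eh v = ereal (LINT \<omega>|M. g2 \<omega>)"
    using v by (rule dom_integrable)
  have mem: "(\<lambda>\<omega>. (1 - s) *\<^sub>R u \<omega> + s *\<^sub>R v \<omega>) \<in> U"
    using u v dom_subset by (intro linear_space_combine U) auto
  have int: "integrable M (\<lambda>\<omega>. (1 - s) * g1 \<omega> + s * g2 \<omega>)" using g1 g2 by simp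
  have le: "AE \<omega> in M. h ((1 - s) *\<^sub>R u \<omega> + s *\<^sub>R v \<omega>) \<omega> \<le> ereal ((1 - s) * g1 \<omega> + s * g2 \<omega>)"
    using g1(2) g2(2) AE_space
  proof eventually_elim
    case (elim \<omega>)
    have "(1 - s) *\<^sub>R (u \<omega>, g1 \<omega>) + s *\<^sub>R (v \<omega>, g2 \<omega>) \<in> ereal_epigraph (\<lambda>x. h x \<omega>)"
      using elim s by (intro convexD_alt epigraph_closed_convex) (auto simp: ereal_epigraph_def)
    then show ?case by (simp add: ereal_epigraph_def)
  qed
  show "(\<lambda>\<omega>. (1 - s) *\<^sub>R u \<omega> + s *\<^sub>R v \<omega>) \<in> domE"
    by (rule Eh_le_integral(1)[OF mem int le])
  have "(LINT \<omega>|M. (1 - s) * g1 \<omega> + s * g2 \<omega>) = (1 - s) * real_of_ereal (Eh u) + s * real_of_ereal (Eh v)"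
    using g1 g2 by simp
  then show "Eh (\<lambda>\<omega>. (1 - s) *\<^sub>R u \<omega> + s *\<^sub>R v \<omega>) \<le>
      ereal ((1 - s) * real_of_ereal (Eh u) + s * real_of_ereal (Eh v))"
    using Eh_le_integral(2)[OF mem int le] by simp
qed

text \<open>Lower semicontinuity at a single point of the domain bounds \<open>Eh\<close> below by an affine
  function of a continuous seminorm, so that a continuous affine minorant exists.\<close>

lemma lsc_imp_conjugate_finite:
  assumes P: "\<And>p. p \<in> P \<Longrightarrow> seminorm_on U p" "P \<noteq> {}"
    and lsc: "lsc_wrt (seminorm_topology U P) Eh"
  obtains \<phi> where "\<phi> \<in> dual U (seminorm_topology U P)" "conjugate_functional U Eh \<phi> < \<infinity>"
proof -
  have top: "topspace (seminorm_topology U P) = U"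
    by (rule topspace_seminorm_topology[OF U(2) P])
  obtain u0 where u0: "u0 \<in> domE" using dom_nonempty by blast
  then have u0U: "u0 \<in> U" using dom_subset by auto
  define f where "f u = real_of_ereal (Eh u)" for u
  have f: "Eh u = ereal (f u)" if "u \<in> domE" for u
    using that by (rule dom_integrable) (simp add: f_def)
  have W: "openin (seminorm_topology U P) {u \<in> U. ereal (f u0 - 1) < Eh u}"
    using lsc by (simp add: lsc_wrt_def top)
  have u0W: "u0 \<in> {u \<in> U. ereal (f u0 - 1) < Eh u}"
    using u0U f[OF u0] by simp
  obtain K e where K: "finite K" "K \<subseteq> P" "0 < e"
    "\<And>v. v \<in> U \<Longrightarrow> (\<Sum>p\<in>K. p (\<lambda>\<omega>. v \<omega> - u0 \<omega>)) < e \<Longrightarrow> v \<in> {u \<in> U. ereal (f u0 - 1) < Eh u}"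
    by (rule seminorm_topology_nhd[OF U(2) P(1) W u0W]) (assumption, rule that)
  define q where "q u = (\<Sum>p\<in>K. p u)" for u :: "'a \<Rightarrow> real^'m"
  have q: "seminorm_on U q"
    unfolding q_def using K P by (intro seminorm_on_sum U) auto
  \<comment> \<open>Scaled so that \<open>Q v = 1\<close> means \<open>q v = e / 2\<close>, safely
    inside the neighbourhood of radius \<open>e\<close>.\<close>
  define Q where "Q u = 2 / e * q u" for u
  have Q: "seminorm_on U Q"
    unfolding Q_def using K(3) by (intro seminorm_on_cmult q) simp
  define D where "D = {v \<in> U. (\<lambda>\<omega>. u0 \<omega> + v \<omega>) \<in> domE}"
  \<comment> \<open>The added 1 compensates for the level \<open>f u0 - 1\<close> on which the
    neighbourhood is based.\<close>
  define F where "F v = f (\<lambda>\<omega>. u0 \<omega> + v \<omega>) - f u0 + 1" for v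
  have comb: "(\<lambda>\<omega>. u0 \<omega> + ((1 - s) *\<^sub>R u \<omega> + s *\<^sub>R v \<omega>)) =
      (\<lambda>\<omega>. (1 - s) *\<^sub>R (u0 \<omega> + u \<omega>) + s *\<^sub>R (u0 \<omega> + v \<omega>))" for u v and s :: real
    by (simp add: algebra_simps)
  have f_conv: "f (\<lambda>\<omega>. (1 - s) *\<^sub>R u \<omega> + s *\<^sub>R v \<omega>) \<le> (1 - s) * f u + s * f v"
    if "u \<in> domE" "v \<in> domE" "0 \<le> s" "s \<le> 1" for u v s
    using convex_combination_Eh(2)[OF that]
    unfolding f[OF convex_combination_Eh(1)[OF that]] f_def[symmetric] by simp
  obtain l where lin: "\<And>u v a b. u \<in> U \<Longrightarrow> v \<in> U \<Longrightarrow> l (\<lambda>\<omega>. a *\<^sub>R u \<omega> + b *\<^sub>R v \<omega>) = a * l u + b * l v"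
    and lQ: "\<And>u. u \<in> U \<Longrightarrow> l u \<le> Q u" and lF: "\<And>v. v \<in> D \<Longrightarrow> l v \<le> F v"
  proof (rule linear_minorant_of_convex[OF U(2) Q, of D F])
    show "D \<subseteq> U" by (auto simp: D_def)
    show "D \<noteq> {}" using u0 U(2) by (auto simp: D_def linear_space_def intro!: exI[of _ "\<lambda>\<omega>. 0"])
  next
    fix u v and s :: real assume *: "u \<in> D" "v \<in> D" "0 \<le> s" "s \<le> 1"
    then have uv: "(\<lambda>\<omega>. u0 \<omega> + u \<omega>) \<in> domE" "(\<lambda>\<omega>. u0 \<omega> + v \<omega>) \<in> domE" by (auto simp: D_def)
    show "(\<lambda>\<omega>. (1 - s) *\<^sub>R u \<omega> + s *\<^sub>R v \<omega>) \<in> D"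
      using * convex_combination_Eh(1)[OF uv *(3,4)]
      by (auto simp: D_def comb intro: linear_space_combine U)
    show "F (\<lambda>\<omega>. (1 - s) *\<^sub>R u \<omega> + s *\<^sub>R v \<omega>) \<le> (1 - s) * F u + s * F v"
      using f_conv[OF uv *(3,4)] unfolding F_def comb by (simp add: algebra_simps)
  next
    fix v assume "v \<in> D"
    then have v: "v \<in> U" "(\<lambda>\<omega>. u0 \<omega> + v \<omega>) \<in> domE" by (auto simp: D_def)
    \<comment> \<open>The fraction of \<open>v\<close> that brings the point into the neighbourhood,
      where \<open>Eh\<close> exceeds \<open>f u0 - 1\<close>. Convexity along the segment then
      stretches this bound by the factor \<open>1 + Q v\<close>.\<close>
    define s where "s = 1 / (1 + Q v)"
    have Q0: "0 \<le> Q v" by (rule seminorm_on_nonneg[OF Q U(2) v(1)])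
    have s: "0 < s" "s \<le> 1" "s * (1 + Q v) = 1" using Q0 by (auto simp: s_def)
    define w where "w = (\<lambda>\<omega>. (1 - s) *\<^sub>R u0 \<omega> + s *\<^sub>R (u0 \<omega> + v \<omega>))"
    have wE: "w \<in> domE"
      unfolding w_def using s by (intro convex_combination_Eh u0 v) auto
    then have wU: "w \<in> U" using dom_subset by auto
    have w_diff: "(\<lambda>\<omega>. w \<omega> - u0 \<omega>) = (\<lambda>\<omega>. s *\<^sub>R v \<omega>)"
      by (simp add: w_def algebra_simps)
    have "q (\<lambda>\<omega>. w \<omega> - u0 \<omega>) = s * q v"
      using s by (simp add: w_diff seminorm_on_scale[OF q U(2) v(1)])
    also have "q v = e / 2 * Q v" using K(3) by (simp add: Q_def)
    also have "s * (e / 2 * Q v) = e / 2 * (s * (1 + Q v) - s)" by (simp add: algebra_simps)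
    also have "\<dots> < e" using s K(3) by (simp add: algebra_simps) (smt (verit) mult_pos_pos)
    finally have "ereal (f u0 - 1) < Eh w"
      using K(4)[OF wU] by (simp add: q_def)
    then have "f u0 - 1 < f w" by (simp add: f[OF wE])
    also have "f w \<le> (1 - s) * f u0 + s * f (\<lambda>\<omega>. u0 \<omega> + v \<omega>)"
      unfolding w_def using s by (intro f_conv u0 v) auto
    finally have "s * (- (1 + Q v)) < s * (f (\<lambda>\<omega>. u0 \<omega> + v \<omega>) - f u0)"
      using s(3) by (simp add: algebra_simps)
    then have "- (1 + Q v) < f (\<lambda>\<omega>. u0 \<omega> + v \<omega>) - f u0"
      using s(1) by (simp only: mult_less_cancel_left_pos)
    then show "- Q v \<le> F v" by (simp add: F_def)
  qed (rule that)
  define \<phi> where "\<phi> = restrict l U"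
  have diff: "l (\<lambda>\<omega>. v \<omega> - u \<omega>) = l v - l u" if "u \<in> U" "v \<in> U" for u v
    using lin[OF that(2,1), of 1 "-1"] by simp
  have absl: "\<bar>l u\<bar> \<le> Q u" if "u \<in> U" for u
  proof -
    have "l (\<lambda>\<omega>. - u \<omega>) = - l u" using lin[OF that that, of "-1" 0] by simp
    moreover have "l (\<lambda>\<omega>. - u \<omega>) \<le> Q (\<lambda>\<omega>. - u \<omega>)"
      using linear_space_minus[OF U(2) that that] by (rule lQ)
    ultimately show ?thesis
      using lQ[OF that] seminorm_on_minus[OF Q U(2) that] by simp
  qed
  have "\<phi> \<in> dual U (seminorm_topology U P)"
    unfolding dual_def
  proof (intro CollectI conjI ballI allI)
    show "\<phi> \<in> extensional U" by (simp add: \<phi>_def)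
    show "\<phi> (\<lambda>\<omega>. a *\<^sub>R u \<omega> + b *\<^sub>R v \<omega>) = a * \<phi> u + b * \<phi> v" if "u \<in> U" "v \<in> U" for u v a b
      using lin[OF that] that linear_space_combine[OF U(2) that] by (simp add: \<phi>_def)
    show "continuous_map (seminorm_topology U P) euclideanreal \<phi>"
      unfolding continuous_map_def top
    proof (intro conjI allI impI)
      fix V :: "real set" assume "openin euclideanreal V"
      then have V: "open V" by simp
      show "openin (seminorm_topology U P) {u \<in> U. \<phi> u \<in> V}"
      proof (rule openin_seminorm_topologyI[OF U(2) P])
        fix u assume "u \<in> {u \<in> U. \<phi> u \<in> V}"
        then have u: "u \<in> U" "l u \<in> V" by (auto simp: \<phi>_def)
        then obtain d where d: "d > 0" "\<And>z. dist z (l u) < d \<Longrightarrow> z \<in> V"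
          using V open_dist by metis
        have "\<phi> v \<in> V" if v: "v \<in> U" "(\<Sum>p\<in>K. p (\<lambda>\<omega>. v \<omega> - u \<omega>)) < d * e / 2" for v
        proof -
          have "\<bar>l v - l u\<bar> \<le> Q (\<lambda>\<omega>. v \<omega> - u \<omega>)"
            using absl[OF linear_space_diff[OF U(2) v(1) u(1)]] diff[OF u(1) v(1)] by simp
          also have "\<dots> < d"
            using v(2) K(3) by (simp add: Q_def q_def field_simps)
          finally show ?thesis using d(2) v(1) by (simp add: \<phi>_def dist_real_def)
        qed
        then show "\<exists>K e. finite K \<and> K \<subseteq> P \<and> 0 < e \<and>
            (\<forall>v\<in>U. (\<Sum>p\<in>K. p (\<lambda>\<omega>. v \<omega> - u \<omega>)) < e \<longrightarrow> v \<in> {u \<in> U. \<phi> u \<in> V})"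
          using K(1-3) d(1) by (intro exI[of _ K] exI[of _ "d * e / 2"]) auto
      qed auto
    qed auto
  qed
  moreover have "conjugate_functional U Eh \<phi> \<le> ereal (l u0 - f u0 + 1)"
    unfolding conjugate_functional_def
  proof (rule SUP_least)
    fix u assume u: "u \<in> U"
    show "ereal (\<phi> u) - Eh u \<le> ereal (l u0 - f u0 + 1)"
    proof (cases "u \<in> domE")
      case True
      have "(\<lambda>\<omega>. u \<omega> - u0 \<omega>) \<in> D"
        using True linear_space_diff[OF U(2) u u0U] by (simp add: D_def)
      from lF[OF this] have "l u - f u \<le> l u0 - f u0 + 1"
        by (simp add: F_def diff[OF u0U u])
      then show ?thesis using u by (simp add: f[OF True] \<phi>_def)
    qed (simp add: Eh_eq_PInf u)
  qed
  then have "conjugate_functional U Eh \<phi> < \<infinity>"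
    by (rule le_less_trans) simp
  ultimately show thesis by (rule that)
qed

theorem lsc_Eh_iff:
  assumes T: "T = seminorm_topology U P"
    and P: "\<And>p. p \<in> P \<Longrightarrow> seminorm_on U p" "P \<noteq> {}"
    and sum: "dual_is_direct_sum M U Y T"
  shows "lsc_wrt T Eh \<longleftrightarrow> lsc_wrt (weak_topology M U Y) Eh"
proof
  assume "lsc_wrt T Eh"
  then obtain \<phi> where \<phi>: "\<phi> \<in> dual U T" "conjugate_functional U Eh \<phi> < \<infinity>"
    using lsc_imp_conjugate_finite[OF P] unfolding T by metis
  obtain yc ys where y: "yc \<in> Y" "ys \<in> singular_dual M U T" "decomposes M U \<phi> yc ys"
    using sum \<phi>(1) unfolding dual_is_direct_sum_def by blast
  have "Ehc yc + support_functional domE ys < \<infinity>"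
    using \<phi> conjugate_functional_Eh[OF \<phi>(1) y] by simp
  \<comment> \<open>In \<open>ereal\<close> infinity plus anything is infinity, so a finite sum
    bounds this summand.\<close>
  then have "Ehc yc < \<infinity>"
    by (cases "Ehc yc") auto
  with y(1) show "lsc_wrt (weak_topology M U Y) Eh"
    by (rule weak_lsc_Eh)
next
  have top: "topspace T = U"
    unfolding T by (rule topspace_seminorm_topology[OF U(2) P])
  \<comment> \<open>Elements of \<open>Y\<close> act as \<open>T\<close>-continuous functionals, and
    subbasic weak neighbourhoods are preimages of intervals under them; hence \<open>T\<close>
    refines the weak topology.\<close>
  have open_T: "openin T W" if "openin (weak_topology M U Y) W" for W
  proof -
    have "generate_topology_on {{v \<in> U. p (\<lambda>\<omega>. v \<omega> - u \<omega>) < e} | p u e.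
        p \<in> (\<lambda>y u. \<bar>pairing M u y\<bar>) ` Y \<and> u \<in> U \<and> 0 < e} W"
      using that unfolding weak_topology_def seminorm_topology_def openin_topology_generated_by_iff .
    then show ?thesis
    proof induction
      case (Basis B)
      then obtain y u e where B: "B = {v \<in> U. \<bar>pairing M (\<lambda>\<omega>. v \<omega> - u \<omega>) y\<bar> < e}" "y \<in> Y" "u \<in> U"
        by blast
      have "functional_of M U y \<in> dual U T"
        using sum B(2) unfolding dual_is_direct_sum_def by blast
      then have "continuous_map T euclideanreal (functional_of M U y)"
        by (simp add: dual_def)
      then have "openin T {v \<in> topspace T. functional_of M U y v \<in> ball (pairing M u y) e}"
        by (rule openin_continuous_map_preimage) simp
      also have "{v \<in> topspace T. functional_of M U y v \<in> ball (pairing M u y) e} = B"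
        using B by (auto simp: top functional_of_def dist_real_def pairing_diff abs_minus_commute)
      finally show ?case .
    qed auto
  qed
  assume "lsc_wrt (weak_topology M U Y) Eh"
  then show "lsc_wrt T Eh"
    using open_T by (auto simp: lsc_wrt_def top topspace_weak_topology)
qed

end

text \<open>The components of \<open>y\<close> are quantified over through \<open>decomposes\<close>
  instead of being chosen; \<open>dual_is_direct_sum\<close> supplies their existence, and their
  uniqueness up to almost sure equality of the \<open>Y\<close>-part.\<close>

theorem theorem14:
  fixes M :: "'a measure"
    and U Y :: "('a \<Rightarrow> real^'m) set"
    and T :: "('a \<Rightarrow> real^'m) topology"
    and h :: "real^'m \<Rightarrow> 'a \<Rightarrow> ereal"
  assumes "prob_space M"
    and "U \<subseteq> borel_measurable M" and "Y \<subseteq> borel_measurable M"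
    and "linear_space U" and "linear_space Y"
    and "separating_duality M U Y"
    and "decomposable M U" and "decomposable M Y"
    and "solid M U" and "solid M Y"
    and "frechet_space M U T"
    and "\<And>W. openin (mackey_topology M U Y) W \<Longrightarrow> openin T W"
    and "dual_is_direct_sum M U Y T"
    and "convex_normal_integrand M h"
    and "proper_on U (integral_functional M h)"
  shows "(\<forall>y\<in>dual U T. \<forall>yc\<in>Y. \<forall>ys\<in>singular_dual M U T. decomposes M U y yc ys \<longrightarrow>
            conjugate_functional U (integral_functional M h) y =
              integral_functional M (conjugate h) yc +
              support_functional (effective_domain U (integral_functional M h)) ys)
       \<and> (lsc_wrt T (integral_functional M h) \<longleftrightarrow>
            lsc_wrt (weak_topology M U Y) (integral_functional M h))
       \<and> (\<forall>v\<in>U. \<forall>y\<in>dual U T. \<forall>yc\<in>Y. \<forall>ys\<in>singular_dual M U T. decomposes M U y yc ys \<longrightarrow>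
            (y \<in> subdifferential U T (integral_functional M h) v \<longleftrightarrow>
              functional_of M U yc \<in> subdifferential U T (integral_functional M h) v \<and>
              ys \<in> normal_cone U T (effective_domain U (integral_functional M h)) v))"
proof -
  interpret prob_space M by fact
  interpret integral_functional_pair M U Y h
    using assms by unfold_locales (auto simp: separating_duality_def)
  obtain p :: "nat \<Rightarrow> ('a \<Rightarrow> real^'m) \<Rightarrow> real"
    where p: "\<forall>n. seminorm_on U (p n)" "T = seminorm_topology U (range p)"
    using \<open>frechet_space M U T\<close> unfolding frechet_space_def by blast
  have "lsc_wrt T Eh \<longleftrightarrow> lsc_wrt (weak_topology M U Y) Eh"
    using p(1) by (intro lsc_Eh_iff[OF p(2) _ _ \<open>dual_is_direct_sum M U Y T\<close>]) auto
  moreover have "functional_of M U yc \<in> dual U T" if "yc \<in> Y" for yc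
    using that \<open>dual_is_direct_sum M U Y T\<close> unfolding dual_is_direct_sum_def by blast
  ultimately show ?thesis
    using conjugate_functional_Eh subdifferential_Eh_iff by blast
qed

end
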